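(* The B-Z constant of the family $\mathcal{P}_3=\{P_n^3 : n\ge 5\}$ of third powers of paths exists and equals $$BZ(\mathcal{P}_3)=\lim_{n\to\infty}\frac{\sum_{T\in\mathcal{T}(P_n^3)}|\mathcal{L}(T)|}{n\cdot\tau(P_n^3)}=\frac37 \left(\frac{45}2 + 9 \sqrt{7} - \frac12 \sqrt{3857 + 1684 \sqrt{7}}\right).$$
   Context: All graphs are finite and simple. $P_n$ is the path graph on $n$ vertices. For a graph $G$ and $k\ge1$, the $k$-th power $G^k$ has $V(G^k)=V(G)$, and $uv$ is an edge iff the distance between $u$ and $v$ in $G$ is at least $1$ and at most $k$. $\mathcal{T}(G)$ is the set of labeled spanning trees of $G$, $\tau(G)=|\mathcal{T}(G)|$, and $\mathcal{L}(T)$ is the set of leaves (vertices of degree exactly $1$ in $T$) of a tree $T$. For a graph family $\mathcal{G}$ indexed by number of vertices, with $G_n$ the member on $n$ vertices, the B-Z constant is $BZ(\mathcal{G}):=\lim_{n\to\infty}\frac{\sum_{T\in\mathcal{T}(G_n)}|\mathcal{L}(T)|}{n\,\tau(G_n)}$ whenever the limit exists. *)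

theory Defs
  imports Complex_Main "HOL-Library.Extended_Nat"
begin

record 'a sgraph =
  vertices :: "'a set"
  edges :: "'a set set"

definition simple_graph :: "'a sgraph \<Rightarrow> bool" where
  "simple_graph G \<longleftrightarrow>
     finite (vertices G) \<and> (\<forall>e\<in>edges G. e \<subseteq> vertices G \<and> card e = 2)"

text \<open>A walk is given by the nonempty list of its vertices; its length is the number of
  edges traversed, that is, the length of the list minus one.\<close>

definition walk :: "'a sgraph \<Rightarrow> 'a list \<Rightarrow> bool" where
  "walk G p \<longleftrightarrow> p \<noteq> [] \<and> set p \<subseteq> vertices G \<and> successively (\<lambda>u v. {u, v} \<in> edges G) p"

definition walk_betw :: "'a sgraph \<Rightarrow> 'a \<Rightarrow> 'a list \<Rightarrow> 'a \<Rightarrow> bool" where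
  "walk_betw G u p v \<longleftrightarrow> walk G p \<and> hd p = u \<and> last p = v"

text \<open>The distance is \<open>\<infinity>\<close> (the infimum of the empty set) if no walk joins the two vertices.\<close>

definition graph_dist :: "'a sgraph \<Rightarrow> 'a \<Rightarrow> 'a \<Rightarrow> enat" where
  "graph_dist G u v = (INF p\<in>{p. walk_betw G u p v}. enat (length p - 1))"

definition graph_power :: "'a sgraph \<Rightarrow> nat \<Rightarrow> 'a sgraph" where
  "graph_power G k =
     \<lparr>vertices = vertices G,
      edges = {{u, v} | u v. u \<in> vertices G \<and> v \<in> vertices G \<and>
                 1 \<le> graph_dist G u v \<and> graph_dist G u v \<le> enat k}\<rparr>"

definition path_graph :: "nat \<Rightarrow> nat sgraph" where
  "path_graph n = \<lparr>vertices = {..<n}, edges = {{i, Suc i} | i. Suc i < n}\<rparr>"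

definition connected_graph :: "'a sgraph \<Rightarrow> bool" where
  "connected_graph G \<longleftrightarrow>
     vertices G \<noteq> {} \<and> (\<forall>u\<in>vertices G. \<forall>v\<in>vertices G. \<exists>p. walk_betw G u p v)"

text \<open>A cycle is listed without repeating its starting vertex.\<close>

definition graph_cycle :: "'a sgraph \<Rightarrow> 'a list \<Rightarrow> bool" where
  "graph_cycle G p \<longleftrightarrow> walk G p \<and> distinct p \<and> 3 \<le> length p \<and> {last p, hd p} \<in> edges G"

definition tree_graph :: "'a sgraph \<Rightarrow> bool" where
  "tree_graph T \<longleftrightarrow> simple_graph T \<and> connected_graph T \<and> (\<nexists>p. graph_cycle T p)"

definition spanning_trees :: "'a sgraph \<Rightarrow> 'a sgraph set" where
  "spanning_trees G = {T. tree_graph T \<and> vertices T = vertices G \<and> edges T \<subseteq> edges G}"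

definition num_spanning_trees :: "'a sgraph \<Rightarrow> nat" where
  "num_spanning_trees G = card (spanning_trees G)"

definition graph_degree :: "'a sgraph \<Rightarrow> 'a \<Rightarrow> nat" where
  "graph_degree G v = card {e \<in> edges G. v \<in> e}"

definition leaves :: "'a sgraph \<Rightarrow> 'a set" where
  "leaves T = {v \<in> vertices T. graph_degree T v = 1}"

text \<open>In the following, \<open>G n\<close> is the member of the family with \<open>n\<close> vertices. Finitely many
  indices for which the family is not defined are irrelevant for the limit.\<close>

definition BZ_ratio :: "(nat \<Rightarrow> 'a sgraph) \<Rightarrow> nat \<Rightarrow> real" where
  "BZ_ratio G n =
     real (\<Sum>T\<in>spanning_trees (G n). card (leaves T)) /
     (real n * real (num_spanning_trees (G n)))"

text \<open>This value is meaningful only if \<open>BZ_ratio G\<close> is \<open>convergent\<close>.\<close>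

definition BZ :: "(nat \<Rightarrow> 'a sgraph) \<Rightarrow> real" where
  "BZ G = lim (BZ_ratio G)"

lemma simple_graph_path_graph: "simple_graph (path_graph n)"
  by (auto simp: simple_graph_def path_graph_def)

lemma graph_dist_self:
  assumes "u \<in> vertices G"
  shows "graph_dist G u u = 0"
proof -
  have "walk_betw G u [u] u"
    using assms by (simp add: walk_betw_def walk_def)
  then have "graph_dist G u u \<le> enat (length [u] - 1)"
    unfolding graph_dist_def by (intro INF_lower) simp
  then show ?thesis by (simp add: enat_0)
qed

lemma simple_graph_graph_power:
  assumes "simple_graph G"
  shows "simple_graph (graph_power G k)"
  unfolding simple_graph_def
proof (intro conjI ballI)
  show "finite (vertices (graph_power G k))"
    using assms by (simp add: simple_graph_def graph_power_def)
next
  fix e assume "e \<in> edges (graph_power G k)"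
  then obtain u v where e: "e = {u, v}" "u \<in> vertices G" "v \<in> vertices G" "1 \<le> graph_dist G u v"
    by (auto simp: graph_power_def)
  then have "u \<noteq> v"
    using graph_dist_self[of u G] by auto
  with e show "e \<subseteq> vertices (graph_power G k)" "card e = 2"
    by (auto simp: graph_power_def)
qed

text \<open>Hence the cardinality and the sum over spanning trees above are not degenerate.\<close>

lemma finite_spanning_trees:
  assumes "simple_graph G"
  shows "finite (spanning_trees G)"
proof (rule finite_subset)
  show "spanning_trees G \<subseteq> (\<lambda>E. \<lparr>vertices = vertices G, edges = E\<rparr>) ` Pow (edges G)"
  proof
    fix T assume "T \<in> spanning_trees G"
    then have "vertices T = vertices G" "edges T \<in> Pow (edges G)"
      by (auto simp: spanning_trees_def)
    then show "T \<in> (\<lambda>E. \<lparr>vertices = vertices G, edges = E\<rparr>) ` Pow (edges G)"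
      by (intro image_eqI[of _ _ "edges T"]) simp_all
  qed
  have "edges G \<subseteq> Pow (vertices G)" "finite (vertices G)"
    using assms by (auto simp: simple_graph_def)
  then show "finite ((\<lambda>E. \<lparr>vertices = vertices G, edges = E\<rparr>) ` Pow (edges G))"
    by (meson finite_Pow_iff finite_imageI finite_subset)
qed

end

theory Submission
  imports Defs
begin

text \<open>The leaves are counted one vertex at a time.  A spanning tree \<open>T\<close> of \<open>P_n^3\<close> has \<open>v\<close> as a leaf with
neighbour \<open>u\<close> exactly if \<open>T\<close> is a spanning tree of the graph that arises from \<open>P_n^3\<close> by deleting all
edges at \<open>v\<close> except \<open>{u, v}\<close>.  So the numerator of the ratio is a sum, over \<open>v\<close> and its at most six
neighbours, of numbers of spanning trees.  All graphs involved are band graphs: every vertex \<open>j\<close>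
is joined to some of \<open>j - 1\<close>, \<open>j - 2\<close>, \<open>j - 3\<close> and to no other smaller vertex.

Spanning trees of band graphs are counted by a transfer matrix.  Build the graph vertex by vertex
and restrict a spanning tree to the first \<open>n\<close> vertices.  This gives a forest each of whose
components meets the window of the last three vertices, and all that the future needs to know about
it is the partition of the window into connected pieces.  There are five partitions, and attaching
the next vertex acts on the vector of numbers of forests by a 5 by 5 matrix, which depends only on
the allowed edges to smaller vertices (\<open>forest_extend_iff\<close>, \<open>count_Suc\<close>).  Let \<open>M\<close> be this
matrix when all three edges are allowed.  Deleting edges at \<open>v\<close> changes the four steps from \<open>v\<close>
to \<open>v + 3\<close>.  If \<open>v\<close> is not near the ends, the product of these steps is the same matrix \<open>K\<close> for
each of the six neighbours \<open>u\<close> (\<open>leaf_transfer_eq\<close>), because it counts the forests of the graph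
without \<open>v\<close>.  Hence, with \<open>s\<close> the initial vector and \<open>r\<close> the unit vector of the one-block
partition, and up to the contribution of the six vertices near the ends, the ratio is
\<open>6 * (\<Sum>i\<le>m. r \<bullet> M^(m - i) K M^i s) / (n * (r \<bullet> M^(m + 4) s))\<close> where \<open>n = m + 7\<close>.

The matrix \<open>M\<close> is primitive, so \<open>M^i z / \<lambda>^i\<close> tends to \<open>(y \<bullet> z) / (y \<bullet> x) x\<close> for its Perron
eigenvalue \<open>\<lambda>\<close> and positive right and left eigenvectors \<open>x\<close> and \<open>y\<close>
(\<open>primitive_matrix_powers_tendsto\<close>).  The mean of a convolution of two convergent sequences tends to
the product of their limits (\<open>convolution_mean_tendsto\<close>), so the ratio tends to
\<open>6 * (y \<bullet> K x) / (\<lambda>^4 * (y \<bullet> x))\<close>.  The characteristic polynomial of \<open>M\<close> is \<open>t - 1\<close> times the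
palindromic quartic \<open>t^4 - 4 t^3 - t^2 - 4 t + 1\<close>, which gives \<open>\<lambda> + 1 / \<lambda> = 2 + sqrt 7\<close>, and both
eigenvectors have entries that are integer polynomials in \<open>\<lambda>\<close>.  The stated closed form is then an
identity modulo the quartic (\<open>eigenvector_ratio\<close>).\<close>

section \<open>Powers of primitive nonnegative matrices\<close>

lemma real_tendsto_0_if_abs_le:
  fixes f g :: "nat \<Rightarrow> real"
  assumes "\<And>n. \<bar>f n\<bar> \<le> g n" "g \<longlonglongrightarrow> 0"
  shows "f \<longlonglongrightarrow> 0"
proof -
  have "\<bar>f n\<bar> \<le> \<bar>g n\<bar> * 1" for n
    using assms(1)[of n] by linarith
  then show ?thesis
    using assms(2) by (intro tendsto_0_le[of g _ f 1]) auto
qed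

definition mv :: "('a::finite \<Rightarrow> 'a \<Rightarrow> real) \<Rightarrow> ('a \<Rightarrow> real) \<Rightarrow> 'a \<Rightarrow> real" where
  "mv M z = (\<lambda>i. \<Sum>j\<in>UNIV. M i j * z j)"

definition dot :: "('a::finite \<Rightarrow> real) \<Rightarrow> ('a \<Rightarrow> real) \<Rightarrow> real" where
  "dot y z = (\<Sum>i\<in>UNIV. y i * z i)"

definition transposed :: "('a \<Rightarrow> 'a \<Rightarrow> real) \<Rightarrow> 'a \<Rightarrow> 'a \<Rightarrow> real" where
  "transposed M = (\<lambda>i j. M j i)"

lemma dot_mv: "dot y (mv M z) = dot (mv (transposed M) y) z"
  unfolding dot_def mv_def transposed_def sum_distrib_left sum_distrib_right
  by (subst sum.swap) (simp add: ac_simps)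

lemma dot_mv_pow: "dot y ((mv M ^^ n) z) = dot ((mv (transposed M) ^^ n) y) z"
  by (induction n arbitrary: y) (simp_all add: dot_mv flip: funpow_swap1)

lemma dot_diff: "dot y (\<lambda>i. z i - w i) = dot y z - dot y w"
  by (simp add: dot_def right_diff_distrib sum_subtractf)

lemma dot_scale: "dot y (\<lambda>i. c * z i) = c * dot y z"
  by (simp add: dot_def sum_distrib_left ac_simps)

lemma dot_indicator: "dot (\<lambda>\<tau>. of_bool (\<tau> = \<sigma>)) z = z \<sigma>"
  by (simp add: dot_def of_bool_def if_distrib[of "\<lambda>c. c * _"] sum.delta cong: if_cong)

lemma dot_commute: "dot y z = dot z y"
  by (simp add: dot_def mult.commute)

lemma mv_scale: "mv M (\<lambda>j. c * z j) = (\<lambda>i. c * mv M z i)"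
  by (simp add: mv_def sum_distrib_left ac_simps)

lemma mv_pow_scale: "(mv M ^^ n) (\<lambda>j. c * z j) = (\<lambda>i. c * (mv M ^^ n) z i)"
  by (induction n) (simp_all add: mv_scale)

lemma mv_diff: "mv M (\<lambda>j. z j - w j) = (\<lambda>i. mv M z i - mv M w i)"
  by (simp add: mv_def sum_subtractf right_diff_distrib)

lemma mv_pow_diff: "(mv M ^^ n) (\<lambda>j. z j - w j) = (\<lambda>i. (mv M ^^ n) z i - (mv M ^^ n) w i)"
  by (induction n) (simp_all add: mv_diff)

lemma mv_pow_eigen:
  assumes "mv M x = (\<lambda>i. l * x i)"
  shows "(mv M ^^ n) x = (\<lambda>i. l ^ n * x i)"
  using assms by (induction n) (simp_all add: mv_scale mult.left_commute mult.assoc)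

lemma mv_pow_eq_mv:
  "(mv M ^^ k) z = mv (\<lambda>i j. (mv M ^^ k) (\<lambda>l. of_bool (l = j)) i) z"
proof (induction k)
  case 0
  have "(\<Sum>j\<in>UNIV. of_bool (i = j) * z j) = z i" for i
    by (simp add: of_bool_def if_distrib[of "\<lambda>c. c * _"] sum.delta cong: if_cong)
  then show ?case by (simp add: mv_def)
next
  case (Suc k)
  show ?case
    unfolding funpow.simps o_apply Suc.IH
    unfolding mv_def sum_distrib_left sum_distrib_right
    by (subst sum.swap) (simp add: ac_simps)
qed

lemma dot_pos:
  assumes "\<And>i. 0 < y i" "\<And>i. 0 \<le> z i" "0 < z k"
  shows "0 < dot y z"
  unfolding dot_def
  using assms by (intro sum_pos2[of _ k]) (auto simp: less_imp_le)

text \<open>If \<open>y\<close> is a left eigenvector, the right-hand side is the eigenvalue times the same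
  weighted norm of \<open>z\<close>.\<close>

lemma weighted_norm_mv_le:
  assumes M: "\<And>i j. 0 \<le> M i j" and y: "\<And>i. 0 \<le> y i"
  shows "dot y (\<lambda>i. \<bar>mv M z i\<bar>) \<le> dot (mv (transposed M) y) (\<lambda>i. \<bar>z i\<bar>)"
proof -
  have "\<bar>mv M z i\<bar> \<le> mv M (\<lambda>j. \<bar>z j\<bar>) i" for i
    unfolding mv_def by (rule order_trans[OF sum_abs]) (simp add: abs_mult M)
  then have "dot y (\<lambda>i. \<bar>mv M z i\<bar>) \<le> dot y (mv M (\<lambda>i. \<bar>z i\<bar>))"
    unfolding dot_def by (intro sum_mono mult_left_mono y)
  then show ?thesis by (simp add: dot_mv)
qed

text \<open>Doeblin's contraction argument.  Subtract from \<open>z\<close> its component along \<open>x\<close>; the rest \<open>w\<close> is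
  orthogonal to \<open>y\<close>.  In the norm \<open>\<Sum>i. y i * \<bar>v i\<bar>\<close> the matrix \<open>M / l\<close> does not expand, because
  \<open>y\<close> is a left eigenvector.  The matrix \<open>B = M^k / l^k\<close> is positive, hence at least \<open>\<delta>\<close> times the
  rank-one matrix with entries \<open>x i * y j\<close>, which annihilates \<open>w\<close>.  Subtracting that multiple
  leaves a nonnegative matrix with the same effect on \<open>w\<close> and contracts the norm by the factor
  \<open>1 - \<delta> * dot y x\<close>.  The unit vectors in the second hypothesis extract the entries of \<open>M^k\<close>.\<close>

theorem primitive_matrix_powers_tendsto:
  fixes M :: "'a::finite \<Rightarrow> 'a \<Rightarrow> real"
  assumes M: "\<And>i j. 0 \<le> M i j"
    and primitive: "\<And>i j. 0 < (mv M ^^ k) (\<lambda>l. of_bool (l = j)) i"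
    and l: "0 < l"
    and x: "mv M x = (\<lambda>i. l * x i)" "\<And>i. 0 < x i"
    and y: "mv (transposed M) y = (\<lambda>i. l * y i)" "\<And>i. 0 < y i"
  shows "(\<lambda>n. (mv M ^^ n) z i / l ^ n) \<longlonglongrightarrow> dot y z / dot y x * x i"
proof -
  have yx: "0 < dot y x"
    using dot_pos[of y x undefined] x(2) y(2) by (simp add: less_imp_le)
  define w where "w = (\<lambda>i. z i - dot y z / dot y x * x i)"
  define N where "N = (\<lambda>v. dot y (\<lambda>i. \<bar>v i\<bar>))"
  have N_scale: "N (\<lambda>i. c * v i) = \<bar>c\<bar> * N v" for c v
    by (simp add: N_def dot_def abs_mult sum_distrib_left ac_simps)
  have N_nonneg: "0 \<le> N v" for v
    using y(2) by (auto simp: N_def dot_def less_imp_le intro!: sum_nonneg)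
  define W where "W = (\<lambda>n. (mv M ^^ n) w)"
  have orth: "dot y (W n) = 0" for n
  proof -
    have "dot y w = 0"
      using yx dot_scale[of y "dot y z / dot y x" x] by (simp add: w_def dot_diff)
    then show ?thesis
      unfolding W_def dot_mv_pow mv_pow_eigen[OF y(1)]
      by (simp add: dot_def mult.assoc flip: sum_distrib_left)
  qed
  define a where "a = (\<lambda>n. N (W n) / l ^ n)"
  have a_nonneg: "0 \<le> a n" for n
    using N_nonneg l by (simp add: a_def)
  have "a (Suc n) \<le> a n" for n
  proof -
    have "N (mv M v) \<le> l * N v" for v
      using weighted_norm_mv_le[of M y v] M y
      by (simp add: N_def less_imp_le dot_def sum_distrib_left ac_simps)
    from this[of "W n"] show ?thesis
      using l by (simp add: a_def W_def field_simps)
  qed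
  then have "decseq a" by (rule decseq_SucI)
  then obtain L where L: "a \<longlonglongrightarrow> L"
    using a_nonneg decseq_convergent[of a 0] by blast
  define B where "B = (\<lambda>i j. (mv M ^^ k) (\<lambda>l. of_bool (l = j)) i / l ^ k)"
  define \<delta> where "\<delta> = Min (range (\<lambda>(i, j). B i j / (x i * y j)))"
  have \<delta>: "0 < \<delta>" "\<delta> * (x i * y j) \<le> B i j" for i j
  proof -
    have "B i j / (x i * y j) > 0" for i j
      using primitive x y l by (simp add: B_def)
    then show "0 < \<delta>"
      unfolding \<delta>_def by (subst Min_gr_iff) auto
    have "\<delta> \<le> B i j / (x i * y j)"
      unfolding \<delta>_def by (intro Min_le) (auto intro: image_eqI[of _ _ "(i, j)"])
    moreover have "0 < x i * y j" using x y by simp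
    ultimately show "\<delta> * (x i * y j) \<le> B i j" by (simp add: pos_le_divide_eq)
  qed
  have mvB: "mv B v = (\<lambda>i. (mv M ^^ k) v i / l ^ k)" for v
    unfolding mv_pow_eq_mv[of k M v] by (simp add: B_def mv_def sum_divide_distrib)
  define C where "C = (\<lambda>i j. B i j - \<delta> * (x i * y j))"
  \<comment> \<open>The vector \<open>y\<close> is a left eigenvector of \<open>C\<close> for the contraction factor.\<close>
  have tC: "mv (transposed C) y = (\<lambda>j. (1 - \<delta> * dot y x) * y j)"
  proof
    fix j
    have "(\<Sum>i\<in>UNIV. B i j * y i) = dot y (mv B (\<lambda>l. of_bool (l = j)))"
      unfolding dot_def mv_def
      by (simp add: of_bool_def if_distrib[of "\<lambda>c. _ * c"] sum.delta ac_simps cong: if_cong)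
    also have "\<dots> = dot y ((mv M ^^ k) (\<lambda>l. of_bool (l = j))) / l ^ k"
      by (simp add: mvB dot_def sum_divide_distrib)
    also have "\<dots> = dot y (\<lambda>l. of_bool (l = j))"
      unfolding dot_mv_pow mv_pow_eigen[OF y(1)] using l
      by (simp add: dot_def mult.assoc flip: sum_distrib_left)
    also have "\<dots> = y j"
      by (simp add: dot_def of_bool_def if_distrib[of "\<lambda>c. _ * c"] sum.delta cong: if_cong)
    finally show "mv (transposed C) y j = (1 - \<delta> * dot y x) * y j"
      by (simp add: mv_def transposed_def C_def dot_def left_diff_distrib right_diff_distrib
            sum_subtractf sum_distrib_left sum_distrib_right ac_simps)
  qed
  have contract: "a (n + k) \<le> (1 - \<delta> * dot y x) * a n" for n
  proof -
    have "(\<lambda>i. W (n + k) i / l ^ k) = mv B (W n)"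
      by (simp add: mvB W_def funpow_add add.commute)
    also have "\<dots> = mv C (W n)"
    proof
      fix i
      have "mv C (W n) i = mv B (W n) i - \<delta> * x i * dot y (W n)"
        by (simp add: C_def mv_def dot_def left_diff_distrib right_diff_distrib sum_subtractf sum_distrib_left ac_simps)
      then show "mv B (W n) i = mv C (W n) i" by (simp add: orth)
    qed
    finally have "N (\<lambda>i. (1 / l ^ k) * W (n + k) i) = N (mv C (W n))" by simp
    also have "\<dots> \<le> dot (mv (transposed C) y) (\<lambda>i. \<bar>W n i\<bar>)"
      unfolding N_def using \<delta>(2) y(2)
      by (intro weighted_norm_mv_le) (auto simp: C_def less_imp_le)
    also have "\<dots> = (1 - \<delta> * dot y x) * N (W n)"
      by (simp only: tC N_def) (simp add: dot_def sum_distrib_left mult.assoc)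
    finally have "N (W (n + k)) / l ^ k \<le> (1 - \<delta> * dot y x) * N (W n)"
      unfolding N_scale using l by simp
    then have "N (W (n + k)) / l ^ k / l ^ n \<le> (1 - \<delta> * dot y x) * N (W n) / l ^ n"
      using l by (intro divide_right_mono) auto
    then show ?thesis by (simp add: a_def power_add ac_simps)
  qed
  \<comment> \<open>The norms decrease along all indices and contract along steps of length \<open>k\<close>, so their limit is zero.\<close>
  have "L \<le> (1 - \<delta> * dot y x) * L"
    using LIMSEQ_ignore_initial_segment[OF L, of k] L contract
    by (intro LIMSEQ_le[of "\<lambda>n. a (n + k)" L "\<lambda>n. (1 - \<delta> * dot y x) * a n"])
       (auto intro: tendsto_mult_left)
  then have "\<delta> * dot y x * L \<le> 0" by (simp add: algebra_simps)
  then have "L \<le> 0"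
    using \<delta>(1) yx by (simp add: mult_le_0_iff)
  moreover have "0 \<le> L" using L a_nonneg by (intro LIMSEQ_le_const) auto
  ultimately have a0: "a \<longlonglongrightarrow> 0" using L by simp
  have bound: "\<bar>W n i / l ^ n\<bar> \<le> a n / y i" for n
  proof -
    have "y i * \<bar>W n i\<bar> \<le> N (W n)"
      unfolding N_def dot_def using y(2)
      by (intro member_le_sum[of i UNIV "\<lambda>i. y i * \<bar>W n i\<bar>"]) (auto simp: less_imp_le)
    then show ?thesis using y(2)[of i] l by (simp add: a_def field_simps)
  qed
  have "(\<lambda>n. W n i / l ^ n) \<longlonglongrightarrow> 0"
    using bound tendsto_divide_zero[OF a0] by (rule real_tendsto_0_if_abs_le)
  then have "(\<lambda>n. W n i / l ^ n + dot y z / dot y x * x i) \<longlonglongrightarrow> 0 + dot y z / dot y x * x i"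
    by (intro tendsto_intros)
  moreover have "W n i / l ^ n + dot y z / dot y x * x i = (mv M ^^ n) z i / l ^ n" for n
  proof -
    have "W n i = (mv M ^^ n) z i - dot y z / dot y x * (l ^ n * x i)"
      unfolding W_def w_def mv_pow_diff mv_pow_scale mv_pow_eigen[OF x(1)] ..
    then show ?thesis using l by (simp add: diff_divide_distrib)
  qed
  ultimately show ?thesis by simp
qed

section \<open>Means of convolutions\<close>

lemma mean_abs_tendsto_0:
  fixes a :: "nat \<Rightarrow> real"
  assumes "a \<longlonglongrightarrow> 0"
  shows "(\<lambda>n. (\<Sum>i\<le>n. \<bar>a i\<bar>) / real (Suc n)) \<longlonglongrightarrow> 0"
proof (rule LIMSEQ_I)
  fix e :: real assume e: "0 < e"
  obtain N where N: "\<bar>a n\<bar> < e / 2" if "n \<ge> N" for n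
    using LIMSEQ_D[OF assms, of "e / 2"] e by auto
  define C where "C = (\<Sum>i<N. \<bar>a i\<bar>)"
  have C: "0 \<le> C" by (auto simp: C_def intro: sum_nonneg)
  obtain N' where N': "2 * C / e < real N'" using reals_Archimedean2 by blast
  show "\<exists>no. \<forall>n\<ge>no. norm ((\<Sum>i\<le>n. \<bar>a i\<bar>) / real (Suc n) - 0) < e"
  proof (intro exI[of _ "max N N'"] allI impI)
    fix n assume n: "max N N' \<le> n"
    have "(\<Sum>i\<le>n. \<bar>a i\<bar>) = C + (\<Sum>i\<in>{N..n}. \<bar>a i\<bar>)"
    proof -
      have "{..n} = {..<N} \<union> {N..n}" using n by auto
      then show ?thesis
        by (simp add: C_def) (subst sum.union_disjoint; auto)
    qed
    also have "(\<Sum>i\<in>{N..n}. \<bar>a i\<bar>) \<le> (\<Sum>i\<in>{N..n}. e / 2)"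
      using N by (intro sum_mono) (auto intro: less_imp_le)
    also have "\<dots> \<le> real (Suc n) * (e / 2)"
      using e by (simp add: mult_right_mono)
    finally have 1: "(\<Sum>i\<le>n. \<bar>a i\<bar>) \<le> C + real (Suc n) * (e / 2)" by simp
    have "2 * C / e < real (Suc n)" using N' n by linarith
    then have "C < real (Suc n) * (e / 2)" using e by (simp add: field_simps)
    with 1 have "(\<Sum>i\<le>n. \<bar>a i\<bar>) < real (Suc n) * e" by simp
    moreover have "0 \<le> (\<Sum>i\<le>n. \<bar>a i\<bar>)" by (auto intro: sum_nonneg)
    ultimately show "norm ((\<Sum>i\<le>n. \<bar>a i\<bar>) / real (Suc n) - 0) < e"
      by (simp add: divide_less_eq mult.commute del: of_nat_Suc)
  qed
qed

text \<open>Replacing \<open>b i\<close> by \<open>B\<close> and then \<open>a (n - i)\<close> by \<open>A\<close> costs, on average, the Cesaro means of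
  \<open>\<bar>b i - B\<bar>\<close> and \<open>\<bar>a i - A\<bar>\<close> up to constant factors.\<close>

lemma convolution_mean_tendsto:
  fixes a b :: "nat \<Rightarrow> real"
  assumes a: "a \<longlonglongrightarrow> A" and b: "b \<longlonglongrightarrow> B"
  shows "(\<lambda>n. (\<Sum>i\<le>n. a (n - i) * b i) / real (Suc n)) \<longlonglongrightarrow> A * B"
proof -
  obtain c where c: "\<bar>a n\<bar> \<le> c" for n
    using a Bseq_def convergent_imp_Bseq convergentI by (metis real_norm_def)
  define f where "f = (\<lambda>n. (\<Sum>i\<le>n. \<bar>b i - B\<bar>) / real (Suc n))"
  define g where "g = (\<lambda>n. (\<Sum>i\<le>n. \<bar>a i - A\<bar>) / real (Suc n))"
  have f: "f \<longlonglongrightarrow> 0" unfolding f_def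
    using mean_abs_tendsto_0[of "\<lambda>n. b n - B"] b by (simp add: LIM_zero)
  have g: "g \<longlonglongrightarrow> 0" unfolding g_def
    using mean_abs_tendsto_0[of "\<lambda>n. a n - A"] a by (simp add: LIM_zero)
  have "\<bar>(\<Sum>i\<le>n. a (n - i) * b i) / real (Suc n) - A * B\<bar> \<le> c * f n + \<bar>B\<bar> * g n" for n
  proof -
    have "(\<Sum>i\<le>n. a (n - i) * b i) - real (Suc n) * (A * B) = (\<Sum>i\<le>n. a (n - i) * b i - A * B)"
      by (simp add: sum_subtractf)
    also have "\<bar>\<dots>\<bar> \<le> (\<Sum>i\<le>n. \<bar>a (n - i) * b i - A * B\<bar>)"
      by (rule sum_abs)
    also have "\<dots> \<le> (\<Sum>i\<le>n. c * \<bar>b i - B\<bar> + \<bar>B\<bar> * \<bar>a (n - i) - A\<bar>)"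
    proof (rule sum_mono)
      fix i
      have "a (n - i) * b i - A * B = a (n - i) * (b i - B) + B * (a (n - i) - A)"
        by (simp add: algebra_simps)
      then have "\<bar>a (n - i) * b i - A * B\<bar> \<le> \<bar>a (n - i)\<bar> * \<bar>b i - B\<bar> + \<bar>B\<bar> * \<bar>a (n - i) - A\<bar>"
        by (metis abs_mult abs_triangle_ineq)
      also have "\<dots> \<le> c * \<bar>b i - B\<bar> + \<bar>B\<bar> * \<bar>a (n - i) - A\<bar>"
        using c by (intro add_right_mono mult_right_mono) auto
      finally show "\<bar>a (n - i) * b i - A * B\<bar> \<le> \<dots>" .
    qed
    also have "\<dots> = c * (\<Sum>i\<le>n. \<bar>b i - B\<bar>) + \<bar>B\<bar> * (\<Sum>i\<le>n. \<bar>a (n - i) - A\<bar>)"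
      by (simp add: sum.distrib sum_distrib_left)
    also have "(\<Sum>i\<le>n. \<bar>a (n - i) - A\<bar>) = (\<Sum>i\<le>n. \<bar>a i - A\<bar>)"
      using sum.nat_diff_reindex[of "\<lambda>i. \<bar>a i - A\<bar>" "Suc n"] by (simp add: lessThan_Suc_atMost)
    finally have "\<bar>(\<Sum>i\<le>n. a (n - i) * b i) - real (Suc n) * (A * B)\<bar> / real (Suc n)
        \<le> (c * (\<Sum>i\<le>n. \<bar>b i - B\<bar>) + \<bar>B\<bar> * (\<Sum>i\<le>n. \<bar>a i - A\<bar>)) / real (Suc n)"
      by (intro divide_right_mono) auto
    moreover have "\<bar>(\<Sum>i\<le>n. a (n - i) * b i) - real (Suc n) * (A * B)\<bar> / real (Suc n)
        = \<bar>(\<Sum>i\<le>n. a (n - i) * b i) / real (Suc n) - A * B\<bar>"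
    proof -
      have "((\<Sum>i\<le>n. a (n - i) * b i) - real (Suc n) * (A * B)) / real (Suc n)
          = (\<Sum>i\<le>n. a (n - i) * b i) / real (Suc n) - A * B"
        by (simp add: diff_divide_distrib del: of_nat_Suc)
      then show ?thesis by (metis abs_divide abs_of_nat)
    qed
    ultimately show ?thesis by (simp add: f_def g_def add_divide_distrib)
  qed
  moreover have "(\<lambda>n. c * f n + \<bar>B\<bar> * g n) \<longlonglongrightarrow> 0"
    using tendsto_add[OF tendsto_mult_left[OF f, of c] tendsto_mult_left[OF g, of "\<bar>B\<bar>"]] by simp
  ultimately have "(\<lambda>n. (\<Sum>i\<le>n. a (n - i) * b i) / real (Suc n) - A * B) \<longlonglongrightarrow> 0"
    by (rule real_tendsto_0_if_abs_le)
  then show ?thesis by (simp add: LIM_zero_iff)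
qed

lemma convolution_mean_dot_tendsto:
  assumes u: "\<And>\<sigma>::'a::finite. (\<lambda>n. u n \<sigma>) \<longlonglongrightarrow> U \<sigma>" and w: "\<And>\<sigma>. (\<lambda>n. w n \<sigma>) \<longlonglongrightarrow> W \<sigma>"
  shows "(\<lambda>n. (\<Sum>i\<le>n. dot (u (n - i)) (w i)) / real (Suc n)) \<longlonglongrightarrow> dot U W"
proof -
  have "(\<lambda>n. \<Sum>\<sigma>\<in>UNIV. (\<Sum>i\<le>n. u (n - i) \<sigma> * w i \<sigma>) / real (Suc n)) \<longlonglongrightarrow> (\<Sum>\<sigma>\<in>UNIV. U \<sigma> * W \<sigma>)"
    by (intro tendsto_sum convolution_mean_tendsto u w)
  moreover have "(\<Sum>\<sigma>\<in>UNIV. (\<Sum>i\<le>n. u (n - i) \<sigma> * w i \<sigma>) / real (Suc n)) =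
      (\<Sum>i\<le>n. dot (u (n - i)) (w i)) / real (Suc n)" for n
    unfolding dot_def sum_divide_distrib[symmetric] by (subst sum.swap) (rule refl)
  ultimately show ?thesis by (simp add: dot_def)
qed

section \<open>Connectivity and cycles when a vertex is attached\<close>

definition conn :: "'a set set \<Rightarrow> 'a \<Rightarrow> 'a \<Rightarrow> bool" where
  "conn E = (\<lambda>a b. {a, b} \<in> E)\<^sup>*\<^sup>*"

definition acyclic_edges :: "'a set set \<Rightarrow> bool" where
  "acyclic_edges E \<longleftrightarrow> (\<nexists>p. distinct p \<and> 3 \<le> length p \<and>
     successively (\<lambda>u v. {u, v} \<in> E) p \<and> {last p, hd p} \<in> E)"

definition star :: "'a \<Rightarrow> 'a set \<Rightarrow> 'a set set" where
  "star x S = (\<lambda>u. {u, x}) ` S"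

lemma conn_refl [simp]: "conn E u u"
  by (simp add: conn_def)

lemma conn_trans: "conn E u v \<Longrightarrow> conn E v w \<Longrightarrow> conn E u w"
  by (simp add: conn_def)

lemma conn_sym: "conn E u v \<longleftrightarrow> conn E v u"
proof -
  have "symp (\<lambda>a b. {a, b} \<in> E)"
    by (auto intro: sympI simp: insert_commute)
  then show ?thesis
    unfolding conn_def by (meson symp_rtranclp sympD)
qed

lemma conn_edge: "{u, v} \<in> E \<Longrightarrow> conn E u v"
  by (auto simp: conn_def)

lemma conn_mono: "conn E u v \<Longrightarrow> E \<subseteq> F \<Longrightarrow> conn F u v"
  unfolding conn_def by (erule rtranclp_mono[THEN predicate2D, rotated]) auto

lemma conn_if_successively:
  "successively (\<lambda>a b. {a, b} \<in> E) p \<Longrightarrow> p \<noteq> [] \<Longrightarrow> conn E (hd p) (last p)"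
proof (induction p rule: induct_list012)
  case (3 x y zs)
  then have "conn E x y" "conn E y (last (y # zs))"
    by (auto intro: conn_edge)
  then show ?case
    by (auto intro: conn_trans)
qed auto

lemma distinct_path_if_conn:
  assumes "conn E u v"
  obtains p where "p \<noteq> []" "distinct p" "hd p = u" "last p = v"
    "successively (\<lambda>a b. {a, b} \<in> E) p"
proof -
  have "\<exists>p. p \<noteq> [] \<and> distinct p \<and> hd p = u \<and> last p = v \<and>
      successively (\<lambda>a b. {a, b} \<in> E) p"
    using assms unfolding conn_def
  proof (induction rule: rtranclp_induct)
    case base
    show ?case by (intro exI[of _ "[u]"]) simp
  next
    case (step y z)
    then obtain p where p: "p \<noteq> []" "distinct p" "hd p = u" "last p = y"
      "successively (\<lambda>a b. {a, b} \<in> E) p" by blast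
    show ?case
    proof (cases "z \<in> set p")
      case True
      then obtain q r where "p = q @ z # r" by (meson split_list)
      then show ?thesis
        using p by (intro exI[of _ "q @ [z]"]) (auto simp: successively_append_iff hd_append)
    next
      case False
      then show ?thesis
        using p step(2) by (intro exI[of _ "p @ [z]"]) (auto simp: successively_append_iff)
    qed
  qed
  then show ?thesis using that by blast
qed

lemma conn_outside:
  assumes "conn E u v" "u \<notin> \<Union>E"
  shows "v = u"
  using assms unfolding conn_def by (induction rule: converse_rtranclp_induct) auto

text \<open>A walk that uses the new vertex \<open>x\<close> enters and leaves it through \<open>S\<close>.\<close>

lemma conn_star_new:
  assumes x: "x \<notin> \<Union>E" "x \<notin> S" and a: "a \<noteq> x"
  shows "conn (E \<union> star x S) a x \<longleftrightarrow> (\<exists>u\<in>S. conn E a u)" (is ?new)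
    and "b \<noteq> x \<Longrightarrow> conn (E \<union> star x S) a b \<longleftrightarrow>
      conn E a b \<or> (\<exists>u\<in>S. conn E a u) \<and> (\<exists>w\<in>S. conn E w b)"
proof -
  let ?E = "E \<union> star x S"
  have into: "conn ?E a x" if "u \<in> S" "conn E a u" for a u
  proof -
    have "conn ?E a u" using that(2) by (rule conn_mono) simp
    moreover have "conn ?E u x" using that(1) by (intro conn_edge) (auto simp: star_def)
    ultimately show ?thesis by (rule conn_trans)
  qed
  have *: "if b = x then \<exists>u\<in>S. conn E a u
      else conn E a b \<or> (\<exists>u\<in>S. conn E a u) \<and> (\<exists>w\<in>S. conn E w b)"
    if "conn ?E a b" for b
    using that unfolding conn_def[of ?E]
  proof (induction rule: rtranclp_induct)
    case base
    show ?case using a by simp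
  next
    case (step y z)
    consider (old) "{y, z} \<in> E" | (new) "{y, z} \<in> star x S"
      using step(2) by auto
    then show ?case
    proof cases
      case old
      with x have "y \<noteq> x" "z \<noteq> x" by auto
      with old step(3) show ?thesis
        by (auto dest: conn_edge intro: conn_trans)
    next
      case new
      then consider "y = x" "z \<in> S" | "z = x" "y \<in> S"
        by (auto simp: star_def doubleton_eq_iff)
      then show ?thesis
      proof cases
        case 1
        with step(3) x show ?thesis by (auto intro: bexI[of _ z])
      next
        case 2
        with x have "y \<noteq> x" by auto
        with 2 step(3) show ?thesis by auto
      qed
    qed
  qed
  from *[of x] into show ?new by auto
  show "conn ?E a b \<longleftrightarrow> conn E a b \<or> (\<exists>u\<in>S. conn E a u) \<and> (\<exists>w\<in>S. conn E w b)"
    if "b \<noteq> x"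
  proof
    assume "conn ?E a b"
    with *[of b] that show "conn E a b \<or> (\<exists>u\<in>S. conn E a u) \<and> (\<exists>w\<in>S. conn E w b)"
      by simp
  next
    assume "conn E a b \<or> (\<exists>u\<in>S. conn E a u) \<and> (\<exists>w\<in>S. conn E w b)"
    then show "conn ?E a b"
    proof
      assume "conn E a b"
      then show ?thesis by (rule conn_mono) simp
    next
      assume "(\<exists>u\<in>S. conn E a u) \<and> (\<exists>w\<in>S. conn E w b)"
      then have "conn ?E a x" "conn ?E b x"
        by (auto intro: into simp: conn_sym[of E _ b])
      then show ?thesis by (metis conn_sym conn_trans)
    qed
  qed
qed

lemma acyclic_edges_mono: "acyclic_edges F \<Longrightarrow> E \<subseteq> F \<Longrightarrow> acyclic_edges E"
  unfolding acyclic_edges_def by (blast intro: successively_mono)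

text \<open>A new cycle passes through \<open>x\<close> and so joins two distinct elements of \<open>S\<close> outside \<open>x\<close>;
  conversely, two elements of \<open>S\<close> that are already connected close a cycle through \<open>x\<close>.\<close>

lemma acyclic_edges_star_iff:
  assumes x: "x \<notin> \<Union>E" "x \<notin> S"
  shows "acyclic_edges (E \<union> star x S) \<longleftrightarrow>
    acyclic_edges E \<and> (\<forall>u\<in>S. \<forall>w\<in>S. conn E u w \<longrightarrow> u = w)"
proof (intro iffI conjI ballI impI)
  let ?E = "E \<union> star x S"
  assume ac: "acyclic_edges ?E"
  then show "acyclic_edges E" by (rule acyclic_edges_mono) simp
  fix u w assume uw: "u \<in> S" "w \<in> S" "conn E u w"
  show "u = w"
  proof (rule ccontr)
    assume "u \<noteq> w"
    obtain p where p: "p \<noteq> []" "distinct p" "hd p = u" "last p = w"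
      "successively (\<lambda>a b. {a, b} \<in> E) p"
      using distinct_path_if_conn[OF uw(3)] .
    have "x \<notin> set p"
    proof
      assume "x \<in> set p"
      then obtain q r where "p = q @ x # r" by (meson split_list)
      then have "conn E u x"
        using p conn_if_successively[of E "q @ [x]"] by (auto simp: successively_append_iff hd_append)
      then have "u = x" using conn_outside[of E x u] x conn_sym[of E] by auto
      with x uw show False by auto
    qed
    moreover have "2 \<le> length p"
      using p \<open>u \<noteq> w\<close> by (cases p rule: list.exhaust; cases "tl p") auto
    moreover have "successively (\<lambda>a b. {a, b} \<in> ?E) p"
      using p(5) by (rule successively_mono) auto
    ultimately have "distinct (p @ [x]) \<and> 3 \<le> length (p @ [x]) \<and>
        successively (\<lambda>a b. {a, b} \<in> ?E) (p @ [x]) \<and> {last (p @ [x]), hd (p @ [x])} \<in> ?E"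
      using p uw by (auto simp: successively_append_iff star_def insert_commute)
    with ac show False unfolding acyclic_edges_def by blast
  qed
next
  let ?E = "E \<union> star x S"
  assume "acyclic_edges E \<and> (\<forall>u\<in>S. \<forall>w\<in>S. conn E u w \<longrightarrow> u = w)"
  then have ac: "acyclic_edges E" and ind: "\<And>u w. u \<in> S \<Longrightarrow> w \<in> S \<Longrightarrow> conn E u w \<Longrightarrow> u = w"
    by auto
  have old: "{a, b} \<in> E" if "{a, b} \<in> ?E" "a \<noteq> x" "b \<noteq> x" for a b
    using that by (auto simp: star_def doubleton_eq_iff)
  have path_old: "successively (\<lambda>a b. {a, b} \<in> E) q"
    if "successively (\<lambda>a b. {a, b} \<in> ?E) q" "x \<notin> set q" for q
    using that by (induction q rule: induct_list012) (auto intro!: old)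
  show "acyclic_edges ?E"
    unfolding acyclic_edges_def
  proof
    assume "\<exists>p. distinct p \<and> 3 \<le> length p \<and>
      successively (\<lambda>u v. {u, v} \<in> ?E) p \<and> {last p, hd p} \<in> ?E"
    then obtain p where p: "distinct p" "3 \<le> length p"
      "successively (\<lambda>u v. {u, v} \<in> ?E) p" "{last p, hd p} \<in> ?E" by blast
    show False
    proof (cases "x \<in> set p")
      case False
      moreover have "last p \<noteq> x" "hd p \<noteq> x"
        using False p(2) hd_in_set[of p] last_in_set[of p] by (cases "p = []"; auto)+
      ultimately show False
        using p ac path_old old unfolding acyclic_edges_def by blast
    next
      case True
      then obtain p1 p2 where pp: "p = p1 @ x # p2" by (meson split_list)
      \<comment> \<open>The cycle rotated so that it starts at \<open>x\<close>, without \<open>x\<close>.\<close>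
      define q where "q = p2 @ p1"
      have q: "distinct q" "2 \<le> length q" "x \<notin> set q"
        using p pp by (auto simp: q_def)
      have seq: "successively (\<lambda>a b. {a, b} \<in> ?E) q" and xs: "{x, hd q} \<in> ?E" "{last q, x} \<in> ?E"
        using p pp q(2) by (auto simp: q_def successively_append_iff successively_Cons hd_append
              last_append split: if_splits)
      have ne: "q \<noteq> []" using q(2) by auto
      have "hd q \<noteq> last q"
        using q(1,2) by (cases q) (auto split: if_splits)
      moreover have "hd q \<in> S" "last q \<in> S"
        using xs x q(3) ne by (auto simp: star_def doubleton_eq_iff)
      moreover have "conn E (hd q) (last q)"
        using path_old[OF seq q(3)] ne by (rule conn_if_successively)
      ultimately show False using ind by blast
    qed
  qed
qed

lemma ex_walk_betw_iff_conn:
  assumes "simple_graph T" "u \<in> vertices T"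
  shows "(\<exists>p. walk_betw T u p v) \<longleftrightarrow> conn (edges T) u v"
proof
  assume "\<exists>p. walk_betw T u p v"
  then show "conn (edges T) u v"
    using conn_if_successively by (fastforce simp: walk_betw_def walk_def)
next
  assume "conn (edges T) u v"
  then have "\<exists>p. walk_betw T u p v"
    unfolding conn_def
  proof (induction rule: rtranclp_induct)
    case base
    show ?case using assms by (intro exI[of _ "[u]"]) (simp add: walk_betw_def walk_def)
  next
    case (step y z)
    then obtain p where "walk_betw T u p y" by blast
    moreover have "z \<in> vertices T"
      using step(2) assms(1) by (auto simp: simple_graph_def)
    ultimately show ?case
      using step(2) by (intro exI[of _ "p @ [z]"])
        (auto simp: walk_betw_def walk_def successively_append_iff)
  qed
  then show "\<exists>p. walk_betw T u p v" .
qed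

lemma connected_graph_iff_conn:
  assumes "simple_graph T"
  shows "connected_graph T \<longleftrightarrow>
    vertices T \<noteq> {} \<and> (\<forall>u\<in>vertices T. \<forall>v\<in>vertices T. conn (edges T) u v)"
  using ex_walk_betw_iff_conn[OF assms] by (auto simp: connected_graph_def)

lemma no_graph_cycle_iff_acyclic_edges:
  assumes "simple_graph T"
  shows "(\<nexists>p. graph_cycle T p) \<longleftrightarrow> acyclic_edges (edges T)"
proof -
  have *: "set p \<subseteq> vertices T"
    if "successively (\<lambda>u v. {u, v} \<in> edges T) p" "2 \<le> length p" for p
    using that
  proof (induction p rule: induct_list012)
    case (3 y z zs)
    have "{y, z} \<subseteq> vertices T"
      using 3(3) assms by (auto simp: simple_graph_def)
    then show ?case using 3 by (cases zs) auto
  qed auto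
  have "graph_cycle T p \<longleftrightarrow> distinct p \<and> 3 \<le> length p \<and>
      successively (\<lambda>u v. {u, v} \<in> edges T) p \<and> {last p, hd p} \<in> edges T" for p
    using *[of p] by (cases "p = []") (force simp: graph_cycle_def walk_def)+
  then show ?thesis by (auto simp: acyclic_edges_def)
qed

lemma tree_graph_iff:
  "tree_graph T \<longleftrightarrow> simple_graph T \<and> vertices T \<noteq> {} \<and>
     (\<forall>u\<in>vertices T. \<forall>v\<in>vertices T. conn (edges T) u v) \<and> acyclic_edges (edges T)"
  using connected_graph_iff_conn[of T] no_graph_cycle_iff_acyclic_edges[of T]
  by (auto simp: tree_graph_def)

section \<open>The transfer matrix on partitions of a three-vertex window\<close>

text \<open>The window below \<open>n\<close> consists of the vertices \<open>n - 3\<close>, \<open>n - 2\<close>, \<open>n - 1\<close>, which the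
  constructor names call \<open>A\<close>, \<open>B\<close>, \<open>C\<close>; an underscore separates the blocks of a partition.\<close>

datatype state = ABC | AB_C | AC_B | A_BC | A_B_C

lemma UNIV_state: "UNIV = {ABC, AB_C, AC_B, A_BC, A_B_C}"
  using state.exhaust by auto

instance state :: finite
  by standard (simp add: UNIV_state)

text \<open>Block labels; the vertex \<open>n - i\<close> of the window is addressed by its offset \<open>i\<close>, so \<open>A\<close>, \<open>B\<close>,
  \<open>C\<close> have the offsets 3, 2, 1.\<close>

fun block :: "state \<Rightarrow> nat \<Rightarrow> nat" where
  "block ABC i = 0"
| "block AB_C i = (if i = 1 then 1 else 0)"
| "block AC_B i = (if i = 2 then 1 else 0)"
| "block A_BC i = (if i = 3 then 1 else 0)"
| "block A_B_C i = i"

definition joined :: "state \<Rightarrow> nat \<Rightarrow> nat \<Rightarrow> bool" where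
  "joined \<sigma> i j \<longleftrightarrow> block \<sigma> i = block \<sigma> j"

text \<open>The effect of joining a new vertex \<open>n\<close> to the window vertices with offsets in \<open>S\<close>.  No
  cycle may arise, and the vertex with offset 3, which leaves the window, must stay connected to
  the new window.  In the new partition \<open>\<sigma>'\<close> the vertex \<open>n\<close> has offset 1, and the old offsets 1
  and 2 become 2 and 3.\<close>

definition moves :: "state \<Rightarrow> nat set \<Rightarrow> state \<Rightarrow> bool" where
  "moves \<sigma> S \<sigma>' \<longleftrightarrow>
     (\<forall>i\<in>S. \<forall>j\<in>S. joined \<sigma> i j \<longrightarrow> i = j) \<and>
     (3 \<in> S \<or> joined \<sigma> 3 1 \<or> joined \<sigma> 3 2) \<and>
     (joined \<sigma>' 1 2 \<longleftrightarrow> (\<exists>i\<in>S. joined \<sigma> 1 i)) \<and>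
     (joined \<sigma>' 1 3 \<longleftrightarrow> (\<exists>i\<in>S. joined \<sigma> 2 i)) \<and>
     (joined \<sigma>' 2 3 \<longleftrightarrow> joined \<sigma> 1 2 \<or> (\<exists>i\<in>S. joined \<sigma> 1 i) \<and> (\<exists>i\<in>S. joined \<sigma> 2 i))"

definition transfer :: "nat set \<Rightarrow> state \<Rightarrow> state \<Rightarrow> real" where
  "transfer D \<sigma>' \<sigma> = real (card {S \<in> Pow D. moves \<sigma> S \<sigma>'})"

lemma transfer_nonneg: "0 \<le> transfer D \<sigma>' \<sigma>"
  by (simp add: transfer_def)

lemma transfer_eq_sum:
  "finite D \<Longrightarrow> transfer D \<sigma>' \<sigma> = (\<Sum>S\<in>Pow D. of_bool (moves \<sigma> S \<sigma>'))"
  unfolding transfer_def by (simp add: sum.inter_filter[symmetric] of_bool_def if_distrib sum.If_cases Int_def)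

text \<open>Unfolds a sum over the subsets of an explicit set, so that the entries of the transfer
  matrices below are computed by rewriting.\<close>

lemma sum_Pow_insert:
  assumes "finite A" "x \<notin> A"
  shows "(\<Sum>S\<in>Pow (insert x A). f S) = (\<Sum>S\<in>Pow A. f S + f (insert x S))"
proof -
  have "inj_on (insert x) (Pow A)"
    using assms(2) by (auto simp: inj_on_def)
  moreover have "Pow A \<inter> insert x ` Pow A = {}"
    using assms(2) by auto
  ultimately show ?thesis
    using assms(1) by (simp add: Pow_insert sum.union_disjoint sum.reindex sum.distrib)
qed

lemmas mv_state = mv_def UNIV_state transfer_eq_sum sum_Pow_insert moves_def joined_def

text \<open>The rows below are the transfer matrices for all subsets of \<open>{1, 2, 3}\<close>.\<close>

lemma mv_transfer_123:
  "mv (transfer {1, 2, 3}) z =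
     (\<lambda>\<sigma>. case \<sigma> of
        ABC \<Rightarrow> 3 * z ABC + 2 * z AB_C + 2 * z AC_B + 2 * z A_BC + z A_B_C
      | AB_C \<Rightarrow> z ABC + z A_BC
      | AC_B \<Rightarrow> 2 * z AB_C + z AC_B + z A_B_C
      | A_BC \<Rightarrow> z AB_C + 2 * z AC_B + z A_B_C
      | A_B_C \<Rightarrow> z AB_C + z AC_B + z A_B_C)"
  by (rule ext) (simp add: mv_state del: sum_of_bool_eq split: state.split)

lemma mv_transfer_12:
  "mv (transfer {1, 2}) z =
     (\<lambda>\<sigma>. case \<sigma> of
        ABC \<Rightarrow> 2 * z ABC + z AB_C + z AC_B
      | AB_C \<Rightarrow> z ABC
      | AC_B \<Rightarrow> z AB_C + z AC_B
      | A_BC \<Rightarrow> z AB_C + z AC_B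
      | A_B_C \<Rightarrow> z AB_C + z AC_B)"
  by (rule ext) (simp add: mv_state del: sum_of_bool_eq split: state.split)

lemma mv_transfer_13:
  "mv (transfer {1, 3}) z =
     (\<lambda>\<sigma>. case \<sigma> of
        ABC \<Rightarrow> 2 * z ABC + z AB_C + z A_BC
      | AB_C \<Rightarrow> z ABC + z A_BC
      | AC_B \<Rightarrow> z AB_C
      | A_BC \<Rightarrow> z AB_C + 2 * z AC_B + z A_B_C
      | A_B_C \<Rightarrow> z AB_C + z AC_B + z A_B_C)"
  by (rule ext) (simp add: mv_state del: sum_of_bool_eq split: state.split)

lemma mv_transfer_23:
  "mv (transfer {2, 3}) z =
     (\<lambda>\<sigma>. case \<sigma> of
        ABC \<Rightarrow> 2 * z ABC + z AC_B + z A_BC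
      | AB_C \<Rightarrow> z ABC + z A_BC
      | AC_B \<Rightarrow> 2 * z AB_C + z AC_B + z A_B_C
      | A_BC \<Rightarrow> z AC_B
      | A_B_C \<Rightarrow> z AB_C + z AC_B + z A_B_C)"
  by (rule ext) (simp add: mv_state del: sum_of_bool_eq split: state.split)

lemma mv_transfer_1:
  "mv (transfer {1}) z =
     (\<lambda>\<sigma>. case \<sigma> of
        ABC \<Rightarrow> z ABC
      | AB_C \<Rightarrow> z ABC
      | AC_B \<Rightarrow> 0
      | A_BC \<Rightarrow> z AB_C + z AC_B
      | A_B_C \<Rightarrow> z AB_C + z AC_B)"
  by (rule ext) (simp add: mv_state del: sum_of_bool_eq split: state.split)

lemma mv_transfer_2:
  "mv (transfer {2}) z =
     (\<lambda>\<sigma>. case \<sigma> of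
        ABC \<Rightarrow> z ABC
      | AB_C \<Rightarrow> z ABC
      | AC_B \<Rightarrow> z AB_C + z AC_B
      | A_BC \<Rightarrow> 0
      | A_B_C \<Rightarrow> z AB_C + z AC_B)"
  by (rule ext) (simp add: mv_state del: sum_of_bool_eq split: state.split)

lemma mv_transfer_3:
  "mv (transfer {3}) z =
     (\<lambda>\<sigma>. case \<sigma> of
        ABC \<Rightarrow> z ABC
      | AB_C \<Rightarrow> z ABC + z A_BC
      | AC_B \<Rightarrow> z AB_C
      | A_BC \<Rightarrow> z AC_B
      | A_B_C \<Rightarrow> z AB_C + z AC_B + z A_B_C)"
  by (rule ext) (simp add: mv_state del: sum_of_bool_eq split: state.split)

lemma mv_transfer_empty:
  "mv (transfer {}) z =
     (\<lambda>\<sigma>. case \<sigma> of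
        ABC \<Rightarrow> 0
      | AB_C \<Rightarrow> z ABC
      | AC_B \<Rightarrow> 0
      | A_BC \<Rightarrow> 0
      | A_B_C \<Rightarrow> z AB_C + z AC_B)"
  by (rule ext) (simp add: mv_state del: sum_of_bool_eq split: state.split)

definition leaf_transfer :: "(state \<Rightarrow> real) \<Rightarrow> state \<Rightarrow> real" where
  "leaf_transfer z =
     (\<lambda>\<sigma>. case \<sigma> of
        ABC \<Rightarrow> 13 * z ABC + 8 * z AB_C + 8 * z AC_B
      | AB_C \<Rightarrow> 5 * z ABC + 3 * z AB_C + 3 * z AC_B
      | AC_B \<Rightarrow> 3 * z ABC + 2 * z AB_C + 2 * z AC_B
      | A_BC \<Rightarrow> 3 * z ABC + 2 * z AB_C + 2 * z AC_B
      | A_B_C \<Rightarrow> 3 * z ABC + 2 * z AB_C + 2 * z AC_B)"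

lemmas mv_transfer = mv_transfer_123 mv_transfer_12 mv_transfer_13 mv_transfer_23
  mv_transfer_1 mv_transfer_2 mv_transfer_3 mv_transfer_empty

text \<open>The four steps at \<open>v\<close>, \<open>v + 1\<close>, \<open>v + 2\<close>, \<open>v + 3\<close> if \<open>v\<close> keeps a single edge, which goes to
  \<open>v - 3\<close>, \<open>v - 2\<close>, \<open>v - 1\<close>, \<open>v + 1\<close>, \<open>v + 2\<close>, \<open>v + 3\<close>, respectively.  The six products agree
  because a vertex with a single edge can be removed without affecting the other connections.\<close>

lemma leaf_transfer_eq:
  shows "mv (transfer {1, 2}) (mv (transfer {1, 3}) (mv (transfer {2, 3}) (mv (transfer {3}) z))) = leaf_transfer z"
    and "mv (transfer {1, 2}) (mv (transfer {1, 3}) (mv (transfer {2, 3}) (mv (transfer {2}) z))) = leaf_transfer z"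
    and "mv (transfer {1, 2}) (mv (transfer {1, 3}) (mv (transfer {2, 3}) (mv (transfer {1}) z))) = leaf_transfer z"
    and "mv (transfer {1, 2}) (mv (transfer {1, 3}) (mv (transfer {1, 2, 3}) (mv (transfer {}) z))) = leaf_transfer z"
    and "mv (transfer {1, 2}) (mv (transfer {1, 2, 3}) (mv (transfer {2, 3}) (mv (transfer {}) z))) = leaf_transfer z"
    and "mv (transfer {1, 2, 3}) (mv (transfer {1, 3}) (mv (transfer {2, 3}) (mv (transfer {}) z))) = leaf_transfer z"
  by (unfold mv_transfer leaf_transfer_def, (rule ext, simp split: state.split)+)

section \<open>Spanning trees of band graphs\<close>

text \<open>The set \<open>D j\<close> contains the distances at which the vertex \<open>j\<close> may have smaller neighbours.\<close>

definition band :: "(nat \<Rightarrow> nat set) \<Rightarrow> nat \<Rightarrow> nat set set" where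
  "band D n = {{j - d, j} | j d. j < n \<and> d \<in> D j \<and> d \<le> j}"

abbreviation band_graph :: "(nat \<Rightarrow> nat set) \<Rightarrow> nat \<Rightarrow> nat sgraph" where
  "band_graph D n \<equiv> \<lparr>vertices = {..<n}, edges = band D n\<rparr>"

definition has_state :: "nat set set \<Rightarrow> nat \<Rightarrow> state \<Rightarrow> bool" where
  "has_state E n \<sigma> \<longleftrightarrow>
     (joined \<sigma> 1 2 \<longleftrightarrow> conn E (n - 1) (n - 2)) \<and>
     (joined \<sigma> 1 3 \<longleftrightarrow> conn E (n - 1) (n - 3)) \<and>
     (joined \<sigma> 2 3 \<longleftrightarrow> conn E (n - 2) (n - 3))"

text \<open>Every component reaches the window, so later vertices can still connect it to the rest.\<close>

definition rooted :: "nat set set \<Rightarrow> nat \<Rightarrow> bool" where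
  "rooted E n \<longleftrightarrow> (\<forall>u<n. \<exists>i\<in>{1, 2, 3}. conn E u (n - i))"

definition forests :: "(nat \<Rightarrow> nat set) \<Rightarrow> nat \<Rightarrow> state \<Rightarrow> nat set set set" where
  "forests D n \<sigma> = {E. E \<subseteq> band D n \<and> acyclic_edges E \<and> rooted E n \<and> has_state E n \<sigma>}"

definition count :: "(nat \<Rightarrow> nat set) \<Rightarrow> nat \<Rightarrow> state \<Rightarrow> real" where
  "count D n \<sigma> = real (card (forests D n \<sigma>))"

lemma band_Suc:
  "band D (Suc n) = band D n \<union> star n ((\<lambda>d. n - d) ` {d \<in> D n. d \<le> n})"
  by (auto simp: band_def star_def less_Suc_eq)

lemma band_subset: "band D n \<subseteq> Pow {..<n}"
  by (auto simp: band_def)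

lemma band_edge:
  assumes "\<And>j. D j \<subseteq> {1, 2, 3}" "e \<in> band D n"
  shows "e \<subseteq> {..<n} \<and> card e = 2"
proof -
  obtain j d where "e = {j - d, j}" "j < n" "d \<in> D j" "d \<le> j"
    using assms(2) by (auto simp: band_def)
  moreover have "d \<noteq> 0" using assms(1)[of j] \<open>d \<in> D j\<close> by auto
  ultimately show ?thesis by auto
qed

lemma band_cong: "(\<And>j. j < n \<Longrightarrow> D j = D' j) \<Longrightarrow> band D n = band D' n"
  by (auto simp: band_def)

lemma count_cong: "(\<And>j. j < n \<Longrightarrow> D j = D' j) \<Longrightarrow> count D n = count D' n"
  using band_cong[of n D D'] by (simp add: count_def forests_def fun_eq_iff)

lemma finite_forests: "finite (forests D n \<sigma>)"
  by (rule finite_subset[of _ "Pow (Pow {..<n})"]) (use band_subset in \<open>auto simp: forests_def\<close>)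

lemma joined_inject:
  assumes "joined \<sigma> 1 2 = joined \<tau> 1 2" "joined \<sigma> 1 3 = joined \<tau> 1 3"
    "joined \<sigma> 2 3 = joined \<tau> 2 3"
  shows "\<sigma> = \<tau>"
  using assms by (cases \<sigma>; cases \<tau>) (simp_all add: joined_def)

lemma joined_refl [simp]: "joined \<sigma> i i"
  by (simp add: joined_def)

lemma joined_sym: "joined \<sigma> i j = joined \<sigma> j i"
  by (auto simp: joined_def)

lemma has_state_unique: "has_state E n \<sigma> \<Longrightarrow> has_state E n \<tau> \<Longrightarrow> \<sigma> = \<tau>"
  by (rule joined_inject) (auto simp: has_state_def)

lemma has_state_exists: "\<exists>\<sigma>. has_state E n \<sigma>"
proof -
  consider "conn E (n - 1) (n - 2)" "conn E (n - 1) (n - 3)" "conn E (n - 2) (n - 3)"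
    | "conn E (n - 1) (n - 2)" "\<not> conn E (n - 1) (n - 3)" "\<not> conn E (n - 2) (n - 3)"
    | "\<not> conn E (n - 1) (n - 2)" "conn E (n - 1) (n - 3)" "\<not> conn E (n - 2) (n - 3)"
    | "\<not> conn E (n - 1) (n - 2)" "\<not> conn E (n - 1) (n - 3)" "conn E (n - 2) (n - 3)"
    | "\<not> conn E (n - 1) (n - 2)" "\<not> conn E (n - 1) (n - 3)" "\<not> conn E (n - 2) (n - 3)"
    by (metis conn_sym conn_trans)
  then show ?thesis
  proof cases
    case 1 then show ?thesis by (intro exI[of _ ABC]) (simp add: has_state_def joined_def)
  next
    case 2 then show ?thesis by (intro exI[of _ A_BC]) (simp add: has_state_def joined_def)
  next
    case 3 then show ?thesis by (intro exI[of _ AC_B]) (simp add: has_state_def joined_def)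
  next
    case 4 then show ?thesis by (intro exI[of _ AB_C]) (simp add: has_state_def joined_def)
  next
    case 5 then show ?thesis by (intro exI[of _ A_B_C]) (simp add: has_state_def joined_def)
  qed
qed

lemma joined_iff_conn:
  assumes "has_state E n \<sigma>" "i \<in> {1, 2, 3}" "j \<in> {1, 2, 3}"
  shows "joined \<sigma> i j \<longleftrightarrow> conn E (n - i) (n - j)"
  using assms by (auto simp: has_state_def joined_sym[of \<sigma> 2 1] joined_sym[of \<sigma> 3 1]
      joined_sym[of \<sigma> 3 2] conn_sym[of E "n - 2" "n - 1"] conn_sym[of E "n - 3" "n - 1"]
      conn_sym[of E "n - 3" "n - 2"] joined_sym[of \<sigma> _ "Suc 0"] conn_sym[of E _ "n - Suc 0"])

text \<open>The correctness of \<open>moves\<close>.  Nothing about \<open>E\<close> beyond its state matters, because the new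
  vertex is attached inside the window only.\<close>

lemma forest_extend_iff:
  assumes n: "3 \<le> n" and E: "\<Union>E \<subseteq> {..<n}" and S: "S \<subseteq> {1, 2, 3}"
    and st: "has_state E n \<sigma>"
  defines "E' \<equiv> E \<union> star n ((\<lambda>d. n - d) ` S)"
  shows "acyclic_edges E' \<and> rooted E' (Suc n) \<and> has_state E' (Suc n) \<sigma>' \<longleftrightarrow>
    acyclic_edges E \<and> rooted E n \<and> moves \<sigma> S \<sigma>'"
proof -
  let ?N = "(\<lambda>d. n - d) ` S"
  have x: "n \<notin> \<Union>E" "n \<notin> ?N" using n E S by auto
  have s: "Suc n - 1 = n" "Suc n - 2 = n - 1" "Suc n - 3 = n - 2" using n by auto
  have le: "i \<le> 3" if "i \<in> S" for i using that S by auto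
  have mono: "conn E a b \<Longrightarrow> conn E' a b" for a b
    unfolding E'_def by (rule conn_mono) auto
  have new: "conn E' a n \<longleftrightarrow> (\<exists>i\<in>S. conn E a (n - i))" if "a < n" for a
    unfolding E'_def using conn_star_new(1)[OF x, of a] that by simp
  have old: "conn E' a b \<longleftrightarrow>
      conn E a b \<or> (\<exists>i\<in>S. conn E a (n - i)) \<and> (\<exists>i\<in>S. conn E b (n - i))"
    if "a < n" "b < n" for a b
    unfolding E'_def using conn_star_new(2)[OF x, of a b] that conn_sym[of E _ b] by simp
  have J: "joined \<sigma> i j \<longleftrightarrow> conn E (n - i) (n - j)" if "i \<in> {1, 2, 3}" "j \<in> {1, 2, 3}" for i j
    using joined_iff_conn[OF st that] .
  have JS: "joined \<sigma> i j \<longleftrightarrow> conn E (n - i) (n - j)" if "i \<in> {1, 2, 3}" "j \<in> S" for i j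
    using that S by (intro J) auto
  have 1: "acyclic_edges E' \<longleftrightarrow> acyclic_edges E \<and> (\<forall>i\<in>S. \<forall>j\<in>S. joined \<sigma> i j \<longrightarrow> i = j)"
  proof -
    have "n - i = n - j \<longleftrightarrow> i = j" if "i \<in> S" "j \<in> S" for i j
      using le[OF that(1)] le[OF that(2)] n by auto
    moreover have "joined \<sigma> i j \<longleftrightarrow> conn E (n - i) (n - j)" if "i \<in> S" "j \<in> S" for i j
      using that S by (intro J) auto
    ultimately show ?thesis
      unfolding E'_def acyclic_edges_star_iff[OF x] by simp
  qed
  have 2: "rooted E' (Suc n) \<longleftrightarrow> rooted E n \<and> (3 \<in> S \<or> joined \<sigma> 3 1 \<or> joined \<sigma> 3 2)"
  proof -
    have root': "rooted E' (Suc n) \<longleftrightarrow>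
        (\<forall>u<n. conn E' u n \<or> conn E' u (n - 1) \<or> conn E' u (n - 2))"
      using n by (simp add: rooted_def All_less_Suc s)
    show ?thesis
    proof
      assume "rooted E' (Suc n)"
      then have *: "(\<exists>i\<in>S. conn E u (n - i)) \<or> conn E u (n - 1) \<or> conn E u (n - 2)" if "u < n" for u
        using that n new[of u] old[of u "n - 1"] old[of u "n - 2"] unfolding root'
        by (metis diff_less less_le_trans zero_less_numeral zero_less_one)
      have "rooted E n"
        unfolding rooted_def
      proof (intro allI impI)
        fix u assume "u < n"
        from *[OF this] show "\<exists>i\<in>{1, 2, 3}. conn E u (n - i)" using S by auto
      qed
      moreover have "3 \<in> S \<or> joined \<sigma> 3 1 \<or> joined \<sigma> 3 2"
        proof -
        have "(\<exists>i\<in>S. joined \<sigma> 3 i) \<or> joined \<sigma> 3 1 \<or> joined \<sigma> 3 2"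
          using *[of "n - 3"] n JS[of 3] J[of 3 1] J[of 3 2] by simp
        then show ?thesis using S by auto
      qed
      ultimately show "rooted E n \<and> (3 \<in> S \<or> joined \<sigma> 3 1 \<or> joined \<sigma> 3 2)" ..
    next
      assume a: "rooted E n \<and> (3 \<in> S \<or> joined \<sigma> 3 1 \<or> joined \<sigma> 3 2)"
      show "rooted E' (Suc n)"
        unfolding root'
      proof (intro allI impI)
        fix u assume u: "u < n"
        with a consider "conn E u (n - 1)" | "conn E u (n - 2)" | "conn E u (n - 3)"
          by (auto simp: rooted_def)
        then show "conn E' u n \<or> conn E' u (n - 1) \<or> conn E' u (n - 2)"
        proof cases
          case 3
          have "3 \<in> S \<or> conn E (n - 3) (n - 1) \<or> conn E (n - 3) (n - 2)"
            using a J[of 3 1] J[of 3 2] by simp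
          then consider "3 \<in> S" | "conn E u (n - 1)" | "conn E u (n - 2)"
            using conn_trans[OF 3] by blast
          then show ?thesis
            using 3 new[OF u] by cases (auto dest: mono)
        qed (auto dest: mono)
      qed
    qed
  qed
  have 3: "has_state E' (Suc n) \<sigma>' \<longleftrightarrow>
      (joined \<sigma>' 1 2 \<longleftrightarrow> (\<exists>i\<in>S. joined \<sigma> 1 i)) \<and>
      (joined \<sigma>' 1 3 \<longleftrightarrow> (\<exists>i\<in>S. joined \<sigma> 2 i)) \<and>
      (joined \<sigma>' 2 3 \<longleftrightarrow> joined \<sigma> 1 2 \<or> (\<exists>i\<in>S. joined \<sigma> 1 i) \<and> (\<exists>i\<in>S. joined \<sigma> 2 i))"
  proof -
    have "conn E' n (n - 1) \<longleftrightarrow> (\<exists>i\<in>S. joined \<sigma> 1 i)"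
      using new[of "n - 1"] n JS[of 1] by (simp add: conn_sym[of E' n "n - Suc 0"])
    moreover have "conn E' n (n - 2) \<longleftrightarrow> (\<exists>i\<in>S. joined \<sigma> 2 i)"
      using new[of "n - 2"] n JS[of 2] by (simp add: conn_sym[of E' n "n - 2"])
    moreover have "conn E' (n - 1) (n - 2) \<longleftrightarrow>
        joined \<sigma> 1 2 \<or> (\<exists>i\<in>S. joined \<sigma> 1 i) \<and> (\<exists>i\<in>S. joined \<sigma> 2 i)"
      using old[of "n - 1" "n - 2"] n JS[of 1] JS[of 2] J[of 1 2] by simp
    ultimately show ?thesis unfolding has_state_def s by auto
  qed
  show ?thesis unfolding 1 2 3 moves_def by (simp only: conj_ac)
qed

text \<open>Every forest on \<open>n + 1\<close> vertices arises from exactly one forest on \<open>n\<close> vertices, its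
  state, and one set of offsets of neighbours of \<open>n\<close>.  For \<open>n \<ge> 3\<close> the window lies inside the
  graph.\<close>

lemma count_Suc:
  assumes n: "3 \<le> n" and D: "D n \<subseteq> {1, 2, 3}"
  shows "count D (Suc n) = mv (transfer (D n)) (count D n)"
proof
  fix \<sigma>'
  define ext where "ext = (\<lambda>(\<sigma>::state, S, E). E \<union> star n ((\<lambda>d. n - d) ` S))"
  define X where "X = (SIGMA \<sigma>:UNIV. {S \<in> Pow (D n). moves \<sigma> S \<sigma>'} \<times> forests D n \<sigma>)"
  have fin: "finite (D n)" using D finite_subset by blast
  have Dn: "{d \<in> D n. d \<le> n} = D n" using n D by auto
  have below: "\<Union>E \<subseteq> {..<n}" if "E \<subseteq> band D n" for E
    using that band_subset[of D n] by blast
  have old: "ext (\<sigma>, S, E) \<inter> {e. n \<notin> e} = E" if "E \<subseteq> band D n" for \<sigma> S E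
    using below[OF that] by (auto simp: ext_def star_def)
  have new: "{d \<in> D n. {n - d, n} \<in> ext (\<sigma>, S, E)} = S"
    if "E \<subseteq> band D n" "S \<subseteq> D n" for \<sigma> S E
  proof -
    have "{n - d, n} \<notin> E" for d using below[OF that(1)] by auto
    moreover have "n - d = n - d' \<longleftrightarrow> d = d'" if "d \<in> D n" "d' \<in> D n" for d d'
    proof -
      have "d \<le> n" "d' \<le> n" using that D n by auto
      then show ?thesis by auto
    qed
    ultimately show ?thesis
      using that(2) by (auto simp: ext_def star_def doubleton_eq_iff) (metis subsetD)+
  qed
  have "inj_on ext X"
  proof (rule inj_onI)
    fix s t assume st: "s \<in> X" "t \<in> X" "ext s = ext t"
    obtain \<sigma> S E where s: "s = (\<sigma>, S, E)" by (cases s)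
    obtain \<tau> R F where t: "t = (\<tau>, R, F)" by (cases t)
    from st s t have EF: "E \<subseteq> band D n" "F \<subseteq> band D n" "S \<subseteq> D n" "R \<subseteq> D n"
      "has_state E n \<sigma>" "has_state F n \<tau>"
      by (auto simp: X_def forests_def)
    have "E = F" "S = R"
      using old[of E \<sigma> S] old[of F \<tau> R] new[of E S \<sigma>] new[of F R \<tau>] EF st(3) s t by metis+
    with EF show "s = t" by (simp add: s t has_state_unique)
  qed
  moreover have "ext ` X = forests D (Suc n) \<sigma>'"
  proof (intro subset_antisym subsetI)
    fix F assume "F \<in> ext ` X"
    then obtain \<sigma> S E where F: "F = E \<union> star n ((\<lambda>d. n - d) ` S)" and
      *: "S \<subseteq> D n" "moves \<sigma> S \<sigma>'" "E \<in> forests D n \<sigma>"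
      by (auto simp: X_def ext_def)
    then have "F \<subseteq> band D (Suc n)"
      unfolding band_Suc Dn by (auto simp: forests_def star_def)
    then show "F \<in> forests D (Suc n) \<sigma>'"
      using forest_extend_iff[of n E S \<sigma> \<sigma>'] below[of E] n * D by (auto simp: forests_def F)
  next
    fix F assume F: "F \<in> forests D (Suc n) \<sigma>'"
    \<comment> \<open>The inverse of \<open>ext\<close> removes the vertex \<open>n\<close> and records its edges.\<close>
    define E where "E = F \<inter> {e. n \<notin> e}"
    define S where "S = {d \<in> D n. {n - d, n} \<in> F}"
    have sub: "F \<subseteq> band D n \<union> star n ((\<lambda>d. n - d) ` D n)"
      using F unfolding forests_def band_Suc Dn by auto
    have E: "E \<subseteq> band D n" using sub by (auto simp: E_def star_def)
    have F_eq: "F = E \<union> star n ((\<lambda>d. n - d) ` S)"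
    proof (intro subset_antisym subsetI)
      fix e assume e: "e \<in> F"
      show "e \<in> E \<union> star n ((\<lambda>d. n - d) ` S)"
      proof (cases "n \<in> e")
        case True
        then have "e \<notin> band D n" using band_subset[of D n] by auto
        with e sub obtain d where "d \<in> D n" "e = {n - d, n}"
          by (auto simp: star_def)
        with e show ?thesis by (auto simp: S_def star_def)
      qed (use e in \<open>simp add: E_def\<close>)
    qed (auto simp: E_def S_def star_def)
    obtain \<sigma> where \<sigma>: "has_state E n \<sigma>" using has_state_exists by blast
    have S: "S \<subseteq> D n" by (auto simp: S_def)
    have "acyclic_edges E \<and> rooted E n \<and> moves \<sigma> S \<sigma>'"
      using forest_extend_iff[of n E S \<sigma> \<sigma>'] below[OF E] n S D \<sigma> F
      by (auto simp: forests_def F_eq)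
    then have "(\<sigma>, S, E) \<in> X" using S E \<sigma> by (auto simp: X_def forests_def)
    moreover have "ext (\<sigma>, S, E) = F" by (simp add: ext_def F_eq)
    ultimately show "F \<in> ext ` X" by force
  qed
  ultimately have "card (forests D (Suc n) \<sigma>') = card X"
    using card_image by metis
  also have "\<dots> = (\<Sum>\<sigma>\<in>UNIV. card {S \<in> Pow (D n). moves \<sigma> S \<sigma>'} * card (forests D n \<sigma>))"
    unfolding X_def using fin finite_forests by (subst card_SigmaI) (auto simp: card_cartesian_product)
  finally show "count D (Suc n) \<sigma>' = mv (transfer (D n)) (count D n) \<sigma>'"
    by (simp add: count_def mv_def transfer_def)
qed

text \<open>A rooted forest whose window is a single block is connected.\<close>

lemma forests_ABC_iff:
  assumes "3 \<le> n"
  shows "E \<in> forests D n ABC \<longleftrightarrow>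
    E \<subseteq> band D n \<and> acyclic_edges E \<and> (\<forall>u<n. \<forall>v<n. conn E u v)"
proof -
  have "rooted E n \<and> has_state E n ABC \<longleftrightarrow> (\<forall>u<n. \<forall>v<n. conn E u v)"
  proof
    assume a: "rooted E n \<and> has_state E n ABC"
    then have w: "conn E (n - i) (n - j)" if "i \<in> {1, 2, 3}" "j \<in> {1, 2, 3}" for i j
      using joined_iff_conn[of E n ABC i j] that by (simp add: joined_def)
    have "conn E u (n - 1)" if u: "u < n" for u
    proof -
      obtain i where i: "i \<in> {1, 2, 3}" "conn E u (n - i)"
        using a u unfolding rooted_def by blast
      have "conn E (n - i) (n - 1)" using i(1) by (intro w) auto
      with i(2) show ?thesis by (rule conn_trans)
    qed
    then show "\<forall>u<n. \<forall>v<n. conn E u v" by (metis conn_sym conn_trans)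
  next
    assume "\<forall>u<n. \<forall>v<n. conn E u v"
    then show "rooted E n \<and> has_state E n ABC"
      using assms by (auto simp: rooted_def has_state_def joined_def)
  qed
  then show ?thesis by (auto simp: forests_def)
qed

lemma spanning_trees_band_graph:
  assumes n: "3 \<le> n" and D: "\<And>j. D j \<subseteq> {1, 2, 3}"
  shows "spanning_trees (band_graph D n) =
    (\<lambda>E. \<lparr>vertices = {..<n}, edges = E\<rparr>) ` forests D n ABC"
proof -
  have "0 \<in> {..<n}" using n by simp
  then have "{..<n} \<noteq> {}" by blast
  then have *: "T \<in> spanning_trees (band_graph D n) \<longleftrightarrow>
      vertices T = {..<n} \<and> edges T \<in> forests D n ABC" for T :: "nat sgraph"
    using n band_edge[of D, OF D]
    by (auto simp: spanning_trees_def tree_graph_iff forests_ABC_iff simple_graph_def)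
  show ?thesis
  proof (intro subset_antisym subsetI)
    fix T assume "T \<in> spanning_trees (band_graph D n)"
    then show "T \<in> (\<lambda>E. \<lparr>vertices = {..<n}, edges = E\<rparr>) ` forests D n ABC"
      using * by (intro image_eqI[of _ _ "edges T"]) auto
  qed (auto simp: *)
qed

lemma inj_graph: "inj_on (\<lambda>E. \<lparr>vertices = V, edges = E\<rparr>) A"
  by (auto simp: inj_on_def)

lemma num_spanning_trees_band_graph:
  assumes "3 \<le> n" "\<And>j. D j \<subseteq> {1, 2, 3}"
  shows "real (num_spanning_trees (band_graph D n)) = count D n ABC"
  using spanning_trees_band_graph[OF assms]
  by (simp add: num_spanning_trees_def count_def card_image inj_graph)

section \<open>The third power of a path as a band graph\<close>

lemma length_walk_path_graph:
  assumes "successively (\<lambda>u v. {u, v} \<in> edges (path_graph n)) p" "p \<noteq> []"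
  shows "max (hd p) (last p) - min (hd p) (last p) \<le> length p - 1"
  using assms
proof (induction p rule: induct_list012)
  case (3 x y zs)
  then have "max y (last (y # zs)) - min y (last (y # zs)) \<le> length zs" "y = Suc x \<or> x = Suc y"
    by (auto simp: path_graph_def doubleton_eq_iff)
  then show ?case by auto
qed auto

text \<open>A walk changes the vertex number by one in each step, and the monotone walk is the shortest.\<close>

lemma graph_dist_path_graph:
  assumes "u < n" "v < n"
  shows "graph_dist (path_graph n) u v = enat (max u v - min u v)"
proof (rule antisym)
  let ?p = "[min u v..<Suc (max u v)]"
  have sym: "{j, i} \<in> edges (path_graph n) \<longleftrightarrow> {i, j} \<in> edges (path_graph n)" for i j
    by (simp add: insert_commute)
  have s: "successively (\<lambda>u v. {u, v} \<in> edges (path_graph n)) ?p"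
    using assms by (auto simp: successively_conv_nth path_graph_def simp del: upt_Suc)
  have w: "walk (path_graph n) ?p"
    using assms s by (auto simp: walk_def path_graph_def simp del: upt_Suc)
  have "\<exists>p. walk_betw (path_graph n) u p v \<and> length p - 1 = max u v - min u v"
  proof (cases "u \<le> v")
    case True
    then show ?thesis using w
      by (intro exI[of _ ?p]) (auto simp: walk_betw_def hd_append)
  next
    case False
    then have "walk (path_graph n) (rev ?p)"
      using w by (simp add: walk_def sym del: upt_Suc)
    moreover have "hd (rev ?p) = u" "last (rev ?p) = v" 
      using False by (auto simp: hd_rev last_rev)
    ultimately show ?thesis using False
      by (intro exI[of _ "rev ?p"]) (auto simp: walk_betw_def simp del: upt_Suc)
  qed
  then obtain p where "walk_betw (path_graph n) u p v" "length p - 1 = max u v - min u v"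
    by blast
  then show "graph_dist (path_graph n) u v \<le> enat (max u v - min u v)"
    unfolding graph_dist_def by (intro INF_lower2[of p]) auto
  show "enat (max u v - min u v) \<le> graph_dist (path_graph n) u v"
    unfolding graph_dist_def
    using length_walk_path_graph[of n] by (intro INF_greatest) (auto simp: walk_betw_def walk_def)
qed

abbreviation offsets :: "nat \<Rightarrow> nat set" where
  "offsets \<equiv> \<lambda>_. {1, 2, 3}"

lemma graph_power_path_graph: "graph_power (path_graph n) 3 = band_graph offsets n"
proof -
  have "{{u, v} | u v. u < n \<and> v < n \<and> 1 \<le> graph_dist (path_graph n) u v \<and>
      graph_dist (path_graph n) u v \<le> enat 3} = band offsets n" (is "?A = _")
  proof (intro subset_antisym subsetI)
    fix e assume "e \<in> ?A"
    then obtain u v where e: "e = {u, v}" "u < n" "v < n"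
      "1 \<le> max u v - min u v" "max u v - min u v \<le> 3"
      by (auto simp: graph_dist_path_graph one_enat_def)
    have "e = {max u v - (max u v - min u v), max u v}"
      using e(1) by (auto simp: max_def min_def)
    moreover have "max u v - min u v \<in> {1, 2, 3}" using e(4,5) by auto
    moreover have "max u v < n" using e by simp
    ultimately show "e \<in> band offsets n"
      unfolding band_def
      by (intro CollectI exI[of _ "max u v"] exI[of _ "max u v - min u v"] conjI) simp_all
  next
    fix e assume "e \<in> band offsets n"
    then obtain j d where e: "e = {j - d, j}" "j < n" "d \<in> {1, 2, 3}" "d \<le> j"
      by (auto simp: band_def)
    then have "j - d < n" "max (j - d) j - min (j - d) j = d" "1 \<le> d" "d \<le> 3" by auto
    with e show "e \<in> ?A"
      by (intro CollectI exI[of _ "j - d"] exI[of _ j] conjI)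
        (simp_all add: graph_dist_path_graph one_enat_def)
  qed
  then show ?thesis
    by (simp add: graph_power_def path_graph_def)
qed

section \<open>Leaves of spanning trees\<close>

lemma count_offsets_pow:
  "count offsets (3 + m) = (mv (transfer {1, 2, 3}) ^^ m) (count offsets 3)"
proof (induction m)
  case (Suc m)
  have "count offsets (Suc (3 + m)) = mv (transfer {1, 2, 3}) (count offsets (3 + m))"
    by (rule count_Suc) auto
  then show ?case by (simp add: Suc.IH del: One_nat_def)
qed simp

text \<open>The offsets that remain in the third power of the path when all edges at \<open>v\<close> except
  \<open>{u, v}\<close> are deleted.\<close>

definition pendant :: "nat \<Rightarrow> nat \<Rightarrow> nat \<Rightarrow> nat set" where
  "pendant v u j = {d \<in> {1, 2, 3}. v \<in> {j - d, j} \<longrightarrow> {j - d, j} = {u, v}}"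

text \<open>The neighbours of a vertex \<open>v\<close> that is at distance at least 3 from both ends.\<close>

definition neighbours :: "nat \<Rightarrow> nat set" where
  "neighbours v = {v - 3, v - 2, v - 1, v + 1, v + 2, v + 3}"

lemma pendant_outside: "j < v \<or> v + 3 < j \<Longrightarrow> pendant v u j = {1, 2, 3}"
  by (auto simp: pendant_def)

lemma pendant_subset: "pendant v u j \<subseteq> {1, 2, 3}"
  by (auto simp: pendant_def)

lemma band_pendant: "band (pendant v u) n = {e \<in> band offsets n. v \<in> e \<longrightarrow> e = {u, v}}"
  by (auto simp: band_def pendant_def)

text \<open>A vertex of a tree with at least two vertices has an edge, so a tree that avoids the deleted
  edges must contain the remaining edge at \<open>v\<close>.\<close>

lemma forests_pendant:
  assumes n: "3 \<le> n" and v: "v < n"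
  shows "forests (pendant v u) n ABC = {E \<in> forests offsets n ABC. {e \<in> E. v \<in> e} = {{u, v}}}"
proof -
  have nonempty: "{e \<in> E. v \<in> e} \<noteq> {}" if "\<forall>u<n. \<forall>v<n. conn E u v" for E
  proof
    assume none: "{e \<in> E. v \<in> e} = {}"
    obtain w where "w < n" "w \<noteq> v" using n by (metis One_nat_def Suc_le_lessD less_numeral_extra(1)
          less_trans nat_neq_iff numeral_3_eq_3 zero_less_Suc lessI)
    then show False using conn_outside[of E v w] that v none by auto
  qed
  have "E \<subseteq> {e \<in> band offsets n. v \<in> e \<longrightarrow> e = {u, v}} \<longleftrightarrow>
      E \<subseteq> band offsets n \<and> {e \<in> E. v \<in> e} = {{u, v}}"
    if c: "\<forall>u<n. \<forall>v<n. conn E u v" for E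
  proof -
    obtain e where "e \<in> E" "v \<in> e" using nonempty[OF c] by auto
    then show ?thesis by auto
  qed
  then show ?thesis
    by (intro set_eqI) (simp add: forests_ABC_iff[OF n] band_pendant conj_ac cong: conj_cong)
qed

lemma leaf_forests_eq:
  assumes v: "3 \<le> v" "v + 3 < n"
  shows "{E \<in> forests offsets n ABC. card {e \<in> E. v \<in> e} = 1} =
    (\<Union>u\<in>neighbours v. forests (pendant v u) n ABC)"
proof -
  have n: "3 \<le> n" "v < n" using v by auto
  have "u \<in> neighbours v" if E: "E \<in> forests offsets n ABC" "{e \<in> E. v \<in> e} = {{u, v}}" for E u
  proof -
    have "{u, v} \<in> band offsets n"
      using E by (auto simp: forests_def)
    then show ?thesis
      by (auto simp: band_def neighbours_def doubleton_eq_iff)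
  qed
  moreover have "\<exists>u. {e \<in> E. v \<in> e} = {{u, v}}"
    if E: "E \<in> forests offsets n ABC" "card {e \<in> E. v \<in> e} = 1" for E
  proof -
    obtain e where e: "{e \<in> E. v \<in> e} = {e}" using E(2) by (auto simp: card_1_singleton_iff)
    then have "e \<in> E" "v \<in> e" by auto
    then obtain j d where "e = {j - d, j}"
      using E(1) by (auto simp: forests_def band_def)
    with \<open>v \<in> e\<close> obtain u where "e = {u, v}" by auto
    with e show ?thesis by auto
  qed
  ultimately show ?thesis
    unfolding forests_pendant[OF n] by auto blast
qed

lemma pendant_steps:
  assumes "3 \<le> v" "u \<in> neighbours v"
  shows "mv (transfer (pendant v u (v + 3))) (mv (transfer (pendant v u (v + 2)))
    (mv (transfer (pendant v u (v + 1))) (mv (transfer (pendant v u v)) z))) = leaf_transfer z"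
proof -
  \<comment> \<open>Shifting by 3 avoids truncated subtraction below \<open>v\<close>.\<close>
  obtain w where w: "v = w + 3" using assms(1) le_Suc_ex by (metis add.commute)
  have eqs: "pendant (w + 3) w (w + 3) = {3}" "pendant (w + 3) (w + 1) (w + 3) = {2}"
    "pendant (w + 3) (w + 2) (w + 3) = {1}" 
    "u \<in> {w + 4, w + 5, w + 6} \<Longrightarrow> pendant (w + 3) u (w + 3) = {}"
    "u \<noteq> w + 4 \<Longrightarrow> pendant (w + 3) u (w + 4) = {2, 3}" "pendant (w + 3) (w + 4) (w + 4) = {1, 2, 3}"
    "u \<noteq> w + 5 \<Longrightarrow> pendant (w + 3) u (w + 5) = {1, 3}" "pendant (w + 3) (w + 5) (w + 5) = {1, 2, 3}"
    "u \<noteq> w + 6 \<Longrightarrow> pendant (w + 3) u (w + 6) = {1, 2}" "pendant (w + 3) (w + 6) (w + 6) = {1, 2, 3}"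
    for u
    by (auto simp: pendant_def doubleton_eq_iff)
  have "u \<in> {w, w + 1, w + 2, w + 4, w + 5, w + 6}"
    using assms(2) by (auto simp: neighbours_def w)
  moreover have "v = w + 3" "v + 1 = w + 4" "v + 2 = w + 5" "v + 3 = w + 6"
    using w by auto
  ultimately show ?thesis
    by (elim insertE emptyE) (simp_all only: eqs, simp_all add: eqs leaf_transfer_eq del: One_nat_def)
qed

lemma count_pendant:
  assumes v: "3 \<le> v" and u: "u \<in> neighbours v"
  shows "count (pendant v u) (v + 4 + m) =
    (mv (transfer {1, 2, 3}) ^^ m) (leaf_transfer (count offsets v))"
proof (induction m)
  case 0
  have "count (pendant v u) v = count offsets v"
    by (rule count_cong) (simp add: pendant_outside)
  moreover have step: "count (pendant v u) k = mv (transfer (pendant v u j)) (count (pendant v u) j)"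
    if "k = Suc j" "3 \<le> j" for j k
    using that count_Suc[OF _ pendant_subset] by simp
  have "count (pendant v u) (v + 1) = mv (transfer (pendant v u v)) (count (pendant v u) v)"
    "count (pendant v u) (v + 2) = mv (transfer (pendant v u (v + 1))) (count (pendant v u) (v + 1))"
    "count (pendant v u) (v + 3) = mv (transfer (pendant v u (v + 2))) (count (pendant v u) (v + 2))"
    "count (pendant v u) (v + 4) = mv (transfer (pendant v u (v + 3))) (count (pendant v u) (v + 3))"
    using v by (auto intro!: step)
  ultimately show ?case
    using pendant_steps[OF v u, of "count offsets v"] by (simp only: add_0_right funpow_0)
next
  case (Suc m)
  have "count (pendant v u) (Suc (v + 4 + m)) =
      mv (transfer (pendant v u (v + 4 + m))) (count (pendant v u) (v + 4 + m))"
    by (rule count_Suc[OF _ pendant_subset]) simp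
  then show ?case by (simp add: Suc pendant_outside)
qed

text \<open>One term for each of the six possible neighbours of the leaf \<open>v\<close>.\<close>

lemma card_leaf_forests:
  assumes v: "3 \<le> v"
  shows "real (card {E \<in> forests offsets (v + 4 + m) ABC. card {e \<in> E. v \<in> e} = 1}) =
    6 * (mv (transfer {1, 2, 3}) ^^ m) (leaf_transfer (count offsets v)) ABC"
proof -
  let ?n = "v + 4 + m"
  have "card {E \<in> forests offsets ?n ABC. card {e \<in> E. v \<in> e} = 1} =
      (\<Sum>u\<in>neighbours v. card (forests (pendant v u) ?n ABC))"
  proof (subst leaf_forests_eq[OF v], simp, intro card_UN_disjoint ballI impI)
    fix u u' :: nat assume "u \<noteq> u'"
    then have "{{u, v}} \<noteq> {{u', v}}" by (auto simp: doubleton_eq_iff)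
    then show "forests (pendant v u) ?n ABC \<inter> forests (pendant v u') ?n ABC = {}"
      using forests_pendant[of ?n v] v by auto
  qed (auto simp: neighbours_def finite_forests)
  then have "real (card {E \<in> forests offsets ?n ABC. card {e \<in> E. v \<in> e} = 1}) =
      (\<Sum>u\<in>neighbours v. count (pendant v u) ?n ABC)"
    by (simp add: count_def)
  also have "\<dots> = (\<Sum>u\<in>neighbours v.
      (mv (transfer {1, 2, 3}) ^^ m) (leaf_transfer (count offsets v)) ABC)"
    by (intro sum.cong) (simp_all add: count_pendant[OF v])
  also have "card (neighbours v) = 6"
    using v by (auto simp: neighbours_def card_insert_if)
  then have "(\<Sum>u\<in>neighbours v.
      (mv (transfer {1, 2, 3}) ^^ m) (leaf_transfer (count offsets v)) ABC) =
      6 * (mv (transfer {1, 2, 3}) ^^ m) (leaf_transfer (count offsets v)) ABC"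
    by simp
  finally show ?thesis .
qed

text \<open>Double counting of the pairs of a tree and one of its leaves.\<close>

lemma sum_leaves:
  assumes n: "3 \<le> n"
  shows "(\<Sum>T\<in>spanning_trees (band_graph offsets n). card (leaves T)) =
    (\<Sum>v<n. card {E \<in> forests offsets n ABC. card {e \<in> E. v \<in> e} = 1})"
proof -
  let ?F = "forests offsets n ABC"
  have "(\<Sum>T\<in>spanning_trees (band_graph offsets n). card (leaves T)) =
      (\<Sum>E\<in>?F. card {v \<in> {..<n}. card {e \<in> E. v \<in> e} = 1})"
    using n by (subst spanning_trees_band_graph)
      (auto simp: sum.reindex inj_graph leaves_def graph_degree_def)
  also have "\<dots> = (\<Sum>v<n. card {E \<in> ?F. card {e \<in> E. v \<in> e} = 1})"
    by (rule sum_multicount_gen[symmetric]) (simp_all add: finite_forests)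
  finally show ?thesis .
qed

section \<open>The dominant eigenvalue and its eigenvectors\<close>

text \<open>The Perron eigenvalue of \<open>transfer {1, 2, 3}\<close>: the larger root of
  \<open>t^2 - (2 + sqrt 7) * t + 1\<close>.\<close>

definition growth :: real where
  "growth = (2 + sqrt 7 + sqrt (7 + 4 * sqrt 7)) / 2"

lemma growth_quadratic: "growth ^ 2 = (2 + sqrt 7) * growth - 1"
proof -
  have "2 * growth - (2 + sqrt 7) = sqrt (7 + 4 * sqrt 7)"
    by (simp add: growth_def field_simps)
  then have "(2 * growth - (2 + sqrt 7)) ^ 2 = 7 + 4 * sqrt 7"
    by simp
  then show ?thesis
    by (simp add: power2_eq_square algebra_simps)
qed

text \<open>The quadratic equation times its conjugate under \<open>sqrt 7 \<mapsto> - sqrt 7\<close>, written as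
  \<open>(t^2 - 2 * t + 1)^2 = 7 * t^2\<close>.\<close>

lemma growth_quartic: "growth ^ 4 = 4 * growth ^ 3 + growth ^ 2 + 4 * growth - 1"
proof -
  have "(growth ^ 2 - 2 * growth + 1) ^ 2 = (sqrt 7 * growth) ^ 2"
    using growth_quadratic by (simp add: algebra_simps)
  then show ?thesis
    by (simp add: power_mult_distrib) (simp add: power2_eq_square eval_nat_numeral algebra_simps)
qed

lemma growth_gt_4: "4 < growth"
proof -
  have "2.6 < sqrt 7" by (rule real_less_rsqrt) (simp add: power2_eq_square)
  moreover from this have "4 < sqrt (7 + 4 * sqrt 7)"
    by (intro real_less_rsqrt) simp
  ultimately show ?thesis by (simp add: growth_def)
qed

text \<open>Solving the eigenvector equations from the last entry upwards, with that entry scaled to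
  \<open>growth^2 + growth\<close>, avoids all denominators; the first entry is reduced modulo the quartic.\<close>

definition right_eigenvector :: "state \<Rightarrow> real" where
  "right_eigenvector \<sigma> = (case \<sigma> of
      ABC \<Rightarrow> 2 * growth ^ 3 + growth
    | AB_C \<Rightarrow> growth ^ 3 - 2 * growth ^ 2
    | AC_B \<Rightarrow> 2 * growth ^ 2 - growth
    | A_BC \<Rightarrow> growth ^ 2 + 3 * growth - 1
    | A_B_C \<Rightarrow> growth ^ 2 + growth)"

text \<open>Obtained in the same way from the first entry, which is scaled to \<open>growth^2 * (growth + 1)\<close> to
  clear denominators; the second, third and last entries are reduced modulo the quartic.\<close>

definition left_eigenvector :: "state \<Rightarrow> real" where
  "left_eigenvector \<sigma> = (case \<sigma> of
      ABC \<Rightarrow> growth ^ 3 + growth ^ 2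
    | AB_C \<Rightarrow> 2 * growth ^ 3 - 2 * growth ^ 2 + 4 * growth - 1
    | AC_B \<Rightarrow> growth ^ 3 + 2 * growth ^ 2 + 3 * growth - 1
    | A_BC \<Rightarrow> growth ^ 3 - growth
    | A_B_C \<Rightarrow> growth ^ 3 + 2 * growth)"

lemma right_eigenvector:
  "mv (transfer {1, 2, 3}) right_eigenvector = (\<lambda>\<sigma>. growth * right_eigenvector \<sigma>)"
  unfolding mv_transfer right_eigenvector_def
  using growth_quartic
  by (intro ext) (simp add: eval_nat_numeral algebra_simps split: state.split)

lemma mv_transposed_transfer:
  "mv (transposed (transfer {1, 2, 3})) y =
     (\<lambda>\<sigma>. case \<sigma> of
        ABC \<Rightarrow> 3 * y ABC + y AB_C
      | AB_C \<Rightarrow> 2 * y ABC + 2 * y AC_B + y A_BC + y A_B_C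
      | AC_B \<Rightarrow> 2 * y ABC + y AC_B + 2 * y A_BC + y A_B_C
      | A_BC \<Rightarrow> 2 * y ABC + y AB_C
      | A_B_C \<Rightarrow> y ABC + y AC_B + y A_BC + y A_B_C)"
  by (rule ext) (simp add: mv_state transposed_def del: sum_of_bool_eq split: state.split)

lemma left_eigenvector:
  "mv (transposed (transfer {1, 2, 3})) left_eigenvector = (\<lambda>\<sigma>. growth * left_eigenvector \<sigma>)"
  unfolding mv_transposed_transfer left_eigenvector_def
  using growth_quartic
  by (intro ext) (simp add: eval_nat_numeral algebra_simps split: state.split)

lemma growth_powers: "4 * growth < growth ^ 2" "4 * growth ^ 2 < growth ^ 3"
  using growth_gt_4 by (simp_all add: eval_nat_numeral)

lemma right_eigenvector_pos: "0 < right_eigenvector \<sigma>"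
  unfolding right_eigenvector_def using growth_gt_4 growth_powers by (cases \<sigma>; simp only: state.case; linarith)

lemma left_eigenvector_pos: "0 < left_eigenvector \<sigma>"
  unfolding left_eigenvector_def using growth_gt_4 growth_powers by (cases \<sigma>; simp only: state.case; linarith)

lemma funpow_2: "(f ^^ 2) z = f (f z)"
  by (simp add: numeral_2_eq_2)

text \<open>The square of the matrix has no zero entry, although the matrix itself has some.\<close>

lemma transfer_primitive:
  "0 < (mv (transfer {1, 2, 3}) ^^ 2) (\<lambda>\<tau>. of_bool (\<tau> = \<sigma>)) \<sigma>'"
  unfolding funpow_2 mv_transfer_123 by (cases \<sigma>; cases \<sigma>') simp_all

lemma transposed_transfer_primitive:
  "0 < (mv (transposed (transfer {1, 2, 3})) ^^ 2) (\<lambda>\<tau>. of_bool (\<tau> = \<sigma>)) \<sigma>'"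
  unfolding funpow_2 mv_transposed_transfer by (cases \<sigma>; cases \<sigma>') simp_all

definition bz :: real where
  "bz = 3 / 7 * (45 / 2 + 9 * sqrt 7 - 1 / 2 * sqrt (3857 + 1684 * sqrt 7))"

text \<open>The radicand \<open>3857 + 1684 * sqrt 7\<close> is \<open>7 + 4 * sqrt 7\<close> times the square of
  \<open>(52 + 5 * sqrt 7) / 3\<close>.\<close>

lemma sqrt_denest:
  "3 * sqrt (3857 + 1684 * sqrt 7) = (52 + 5 * sqrt 7) * sqrt (7 + 4 * sqrt 7)"
proof -
  have "(((52 + 5 * sqrt 7) * sqrt (7 + 4 * sqrt 7)) / 3) ^ 2 = 3857 + 1684 * sqrt 7"
    by (simp add: power_mult_distrib power_divide)
       (simp add: power2_eq_square algebra_simps)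
  then have "sqrt (3857 + 1684 * sqrt 7) = ((52 + 5 * sqrt 7) * sqrt (7 + 4 * sqrt 7)) / 3"
    by (intro real_sqrt_unique) auto
  then show ?thesis by simp
qed

text \<open>Eliminates the nested radical by \<open>sqrt (7 + 4 * sqrt 7) = 2 * growth - 2 - sqrt 7\<close> and then
  \<open>sqrt 7\<close> by \<open>sqrt 7 = growth + 1 / growth - 2\<close>.\<close>

lemma bz_times_growth: "7 * bz * growth = 58 + 16 * growth + 16 * growth ^ 2 - 5 * growth ^ 3"
proof -
  have w: "sqrt (7 + 4 * sqrt 7) = 2 * growth - (2 + sqrt 7)"
    by (simp add: growth_def field_simps)
  have "42 * bz = 405 + 162 * sqrt 7 - 3 * (3 * sqrt (3857 + 1684 * sqrt 7))"
    by (simp add: bz_def)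
  then have "42 * bz = 405 + 162 * sqrt 7 - 3 * ((52 + 5 * sqrt 7) * (2 * growth - (2 + sqrt 7)))"
    unfolding sqrt_denest w .
  then have bz: "7 * bz = 137 + 58 * sqrt 7 - 52 * growth - 5 * (sqrt 7 * growth)"
    by (simp add: algebra_simps)
  have s: "sqrt 7 * growth = growth ^ 2 + 1 - 2 * growth"
    using growth_quadratic by (simp add: algebra_simps)
  have "7 * bz * growth =
      137 * growth + 58 * (sqrt 7 * growth) - 52 * growth ^ 2 - 5 * (sqrt 7 * growth) * growth"
    unfolding bz by (simp add: power2_eq_square algebra_simps)
  then show ?thesis
    unfolding s by (simp add: power2_eq_square power3_eq_cube algebra_simps)
qed

text \<open>Both sides are polynomials in \<open>growth\<close>.  The explicit cofactors are the quotients of the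
  division by the quartic.\<close>

lemma eigenvector_ratio:
  "6 * dot left_eigenvector (leaf_transfer right_eigenvector) =
     bz * growth ^ 4 * dot left_eigenvector right_eigenvector"
proof -
  let ?g = growth
  have q: "?g ^ 4 - 4 * ?g ^ 3 - ?g ^ 2 - 4 * ?g + 1 = 0"
    using growth_quartic by simp
  have yx: "dot left_eigenvector right_eigenvector = 364 * ?g ^ 3 + 140 * ?g ^ 2 + 322 * ?g - 84"
  proof -
    have "dot left_eigenvector right_eigenvector - (364 * ?g ^ 3 + 140 * ?g ^ 2 + 322 * ?g - 84) =
        (4 * ?g ^ 2 + 16 * ?g + 84) * (?g ^ 4 - 4 * ?g ^ 3 - ?g ^ 2 - 4 * ?g + 1)"
      by (simp add: dot_def UNIV_state left_eigenvector_def right_eigenvector_def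
          eval_nat_numeral algebra_simps)
    then show ?thesis unfolding q by simp
  qed
  have yKx: "dot left_eigenvector (leaf_transfer right_eigenvector) =
      7158 * ?g ^ 3 + 2988 * ?g ^ 2 + 6117 * ?g - 1620"
  proof -
    have "dot left_eigenvector (leaf_transfer right_eigenvector) -
        (7158 * ?g ^ 3 + 2988 * ?g ^ 2 + 6117 * ?g - 1620) =
        (84 * ?g ^ 2 + 360 * ?g + 1620) * (?g ^ 4 - 4 * ?g ^ 3 - ?g ^ 2 - 4 * ?g + 1)"
      by (simp add: dot_def UNIV_state left_eigenvector_def right_eigenvector_def
          leaf_transfer_def eval_nat_numeral algebra_simps)
    then show ?thesis unfolding q by simp
  qed
  have "7 * (6 * dot left_eigenvector (leaf_transfer right_eigenvector)
        - bz * ?g ^ 4 * dot left_eigenvector right_eigenvector) =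
      42 * (7158 * ?g ^ 3 + 2988 * ?g ^ 2 + 6117 * ?g - 1620)
        - 7 * bz * ?g * (?g ^ 3 * (364 * ?g ^ 3 + 140 * ?g ^ 2 + 322 * ?g - 84))"
    unfolding yx yKx by (simp add: eval_nat_numeral algebra_simps)
  also have "\<dots> = (1820 * ?g ^ 5 + 2156 * ?g ^ 4 + 3990 * ?g ^ 3 - 3528 * ?g ^ 2
        - 15246 * ?g - 68040) * (?g ^ 4 - 4 * ?g ^ 3 - ?g ^ 2 - 4 * ?g + 1)"
    unfolding bz_times_growth by (simp add: eval_nat_numeral algebra_simps)
  finally show ?thesis unfolding q by simp
qed

section \<open>The limit of the leaf ratio\<close>

lemma sum_lessThan_add:
  fixes f :: "nat \<Rightarrow> 'a::comm_monoid_add"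
  shows "(\<Sum>v<a + b. f v) = (\<Sum>v<a. f v) + (\<Sum>i<b. f (a + i))"
  by (induction b) (simp_all add: add.assoc)

lemma leaf_transfer_scale: "leaf_transfer (\<lambda>\<sigma>. c * z \<sigma>) = (\<lambda>\<sigma>. c * leaf_transfer z \<sigma>)"
  by (rule ext) (simp add: leaf_transfer_def algebra_simps split: state.split)

lemma tendsto_leaf_transfer:
  assumes "\<And>\<sigma>. (\<lambda>n. z n \<sigma>) \<longlonglongrightarrow> x \<sigma>"
  shows "(\<lambda>n. leaf_transfer (z n) \<sigma>) \<longlonglongrightarrow> leaf_transfer x \<sigma>"
  by (cases \<sigma>) (auto simp: leaf_transfer_def intro!: tendsto_intros assms)

text \<open>Witnessed by the edgeless graph on three vertices.  It makes the pairing of the initial vector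
  with the positive left eigenvector positive.\<close>

lemma count_start_pos: "0 < count offsets 3 A_B_C"
proof -
  have "conn {} a b \<longleftrightarrow> a = b" for a b :: nat
    using conn_outside[of "{}" a b] by auto
  moreover have "rooted {} 3"
    unfolding rooted_def
  proof (intro allI impI)
    fix u :: nat assume "u < 3"
    then show "\<exists>i\<in>{1, 2, 3}. conn {} u (3 - i)"
      by (intro bexI[of _ "3 - u"]) auto
  qed
  ultimately have "{} \<in> forests offsets 3 A_B_C"
    by (auto simp: forests_def acyclic_edges_def has_state_def joined_def)
  then show ?thesis
    using finite_forests[of offsets 3 A_B_C] by (auto simp: count_def card_gt_0_iff)
qed

text \<open>The sequences \<open>w\<close> and \<open>u\<close> are the initial vector and the unit vector of the one-block
  partition, propagated from the two ends of the path and normalised.  For \<open>n = m + 7\<close> the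
  vertices \<open>3 + i\<close> with \<open>i \<le> m\<close> are exactly those with three further vertices on either side; each
  contributes \<open>6 * growth^m\<close> times the pairing of \<open>u (m - i)\<close> with the image of \<open>w i\<close>.  The other six
  vertices contribute \<open>R m\<close>, at most six times the number of spanning trees.\<close>

lemma BZ_ratio_tendsto:
  "BZ_ratio (\<lambda>n. graph_power (path_graph n) 3) \<longlonglongrightarrow> bz"
proof -
  let ?M = "transfer {1, 2, 3}" and ?l = growth and ?s = "count offsets 3"
  let ?x = right_eigenvector and ?y = left_eigenvector
  let ?r = "\<lambda>\<tau>. of_bool (\<tau> = ABC)"
  define w where "w = (\<lambda>m \<sigma>. (mv ?M ^^ m) ?s \<sigma> / ?l ^ m)"
  define u where "u = (\<lambda>m \<sigma>. (mv (transposed ?M) ^^ m) ?r \<sigma> / ?l ^ m)"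
  define c where "c = dot ?y ?s / dot ?y ?x"
  define d where "d = ?x ABC / dot ?y ?x"
  have l: "0 < ?l" using growth_gt_4 by simp
  have yx: "0 < dot ?y ?x"
    using right_eigenvector_pos left_eigenvector_pos
    by (intro dot_pos[of _ _ ABC]) (auto intro: less_imp_le)
  have "0 < dot ?y ?s"
    using left_eigenvector_pos count_start_pos
    by (intro dot_pos[of _ _ A_B_C]) (auto simp: count_def)
  then have c: "0 < c" using yx by (simp add: c_def)
  have w: "(\<lambda>m. w m \<sigma>) \<longlonglongrightarrow> c * ?x \<sigma>" for \<sigma>
    unfolding w_def c_def
    by (rule primitive_matrix_powers_tendsto[OF transfer_nonneg transfer_primitive l right_eigenvector
          right_eigenvector_pos left_eigenvector left_eigenvector_pos])
  have "(\<lambda>m. u m \<sigma>) \<longlonglongrightarrow> dot ?x ?r / dot ?x ?y * ?y \<sigma>" for \<sigma>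
    unfolding u_def
    by (rule primitive_matrix_powers_tendsto[OF _ transposed_transfer_primitive l left_eigenvector
          left_eigenvector_pos _ right_eigenvector_pos])
       (simp_all add: transposed_def transfer_nonneg right_eigenvector[unfolded One_nat_def])
  then have u: "(\<lambda>m. u m \<sigma>) \<longlonglongrightarrow> d * ?y \<sigma>" for \<sigma>
    by (simp add: d_def dot_commute[of ?x] dot_indicator)
  define t where "t = (\<lambda>m. count offsets (m + 7) ABC)"
  have count_w: "count offsets (3 + m) = (\<lambda>\<sigma>. ?l ^ m * w m \<sigma>)" for m
    unfolding count_offsets_pow w_def using l by simp
  have t: "t m = ?l ^ m * (?l ^ 4 * w (m + 4) ABC)" for m
    using count_w[of "m + 4"] by (simp add: t_def power_add add.commute)
  define S where "S = (\<lambda>m. \<Sum>i\<le>m. dot (u (m - i)) (leaf_transfer (w i)))"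
  define B where "B = (\<lambda>m v. real (card {E \<in> forests offsets (m + 7) ABC. card {e \<in> E. v \<in> e} = 1}))"
  have B_le: "B m v \<le> t m" for m v
    unfolding B_def t_def count_def by (simp add: card_mono finite_forests)
  have B_mid: "B m (3 + i) = 6 * ?l ^ m * dot (u (m - i)) (leaf_transfer (w i))" if "i \<le> m" for i m
  proof -
    have "m + 7 = (3 + i) + 4 + (m - i)" using that by simp
    then have "B m (3 + i) = 6 * (mv ?M ^^ (m - i)) (leaf_transfer (count offsets (3 + i))) ABC"
      unfolding B_def using card_leaf_forests[of "3 + i" "m - i"] by (simp only: le_add1)
    also have "\<dots> = 6 * dot ?r ((mv ?M ^^ (m - i)) (leaf_transfer (count offsets (3 + i))))"
      by (simp only: dot_indicator)
    also have "\<dots> = 6 * (?l ^ (m - i) * ?l ^ i) * dot (u (m - i)) (leaf_transfer (w i))"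
      unfolding dot_mv_pow count_w leaf_transfer_scale dot_scale u_def
      using l by (simp add: dot_def sum_divide_distrib[symmetric])
    also have "?l ^ (m - i) * ?l ^ i = ?l ^ m"
      using that by (simp flip: power_add)
    finally show ?thesis .
  qed
  define R where "R = (\<lambda>m. (\<Sum>v<3. B m v) + (\<Sum>k<3. B m (m + 4 + k)))"
  have total: "(\<Sum>v<m + 7. B m v) = R m + 6 * ?l ^ m * S m" for m
  proof -
    have "(\<Sum>v<(3 + Suc m) + 3. B m v) =
        (\<Sum>v<3. B m v) + (\<Sum>i<Suc m. B m (3 + i)) + (\<Sum>k<3. B m (3 + Suc m + k))"
      by (simp only: sum_lessThan_add)
    moreover have "(\<Sum>i<Suc m. B m (3 + i)) = 6 * ?l ^ m * S m"
      unfolding S_def sum_distrib_left lessThan_Suc_atMost by (intro sum.cong B_mid) auto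
    moreover have "(3 + Suc m) + 3 = m + 7" "3 + Suc m = m + 4" by auto
    ultimately show ?thesis by (simp only: R_def)
  qed
  have R: "0 \<le> R m" "R m \<le> 6 * t m" for m
  proof -
    show "0 \<le> R m" by (auto simp: R_def B_def intro!: add_nonneg_nonneg sum_nonneg)
    have "(\<Sum>v<3. B m v) \<le> (\<Sum>v<(3::nat). t m)" "(\<Sum>k<3. B m (m + 4 + k)) \<le> (\<Sum>k<(3::nat). t m)"
      by (intro sum_mono B_le)+
    then show "R m \<le> 6 * t m" by (simp add: R_def)
  qed
  have ratio: "BZ_ratio (\<lambda>n. graph_power (path_graph n) 3) (m + 7) =
      R m / (real (m + 7) * t m) + 6 * ?l ^ m * S m / (real (m + 7) * t m)" for m
  proof -
    have "real (\<Sum>T\<in>spanning_trees (band_graph offsets (m + 7)). card (leaves T)) = (\<Sum>v<m + 7. B m v)"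
      using sum_leaves[of "m + 7"] by (simp add: B_def)
    then show ?thesis
      using num_spanning_trees_band_graph[of "m + 7" offsets]
      by (simp add: BZ_ratio_def graph_power_path_graph total t_def add_divide_distrib)
  qed
  have "(\<lambda>m. R m / (real (m + 7) * t m)) \<longlonglongrightarrow> 0"
  proof (rule real_tendsto_0_if_abs_le)
    fix m
    have "R m / (real (m + 7) * t m) \<le> 6 / real (m + 7)"
    proof (cases "t m = 0")
      case False
      then have "0 < t m" by (simp add: t_def count_def)
      then have "R m / t m \<le> 6" using R(2)[of m] by (simp add: pos_divide_le_eq)
      then have "R m / t m / real (m + 7) \<le> 6 / real (m + 7)" by (rule divide_right_mono) simp
      then show ?thesis by (simp add: mult.commute)
    qed simp
    moreover have "0 \<le> R m / (real (m + 7) * t m)"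
      using R(1)[of m] by (simp add: t_def count_def)
    ultimately show "\<bar>R m / (real (m + 7) * t m)\<bar> \<le> 6 / real (m + 7)" by (simp only: abs_of_nonneg)
  next
    show "(\<lambda>m. 6 / real (m + 7)) \<longlonglongrightarrow> 0"
      using LIMSEQ_ignore_initial_segment[OF lim_const_over_n[of "6::real"], of 7] by simp
  qed
  moreover have "(\<lambda>m. 6 * ?l ^ m * S m / (real (m + 7) * t m)) \<longlonglongrightarrow> bz"
  proof -
    have S: "(\<lambda>m. S m / real (Suc m)) \<longlonglongrightarrow> dot (\<lambda>\<sigma>. d * ?y \<sigma>) (leaf_transfer (\<lambda>\<sigma>. c * ?x \<sigma>))"
      unfolding S_def by (intro convolution_mean_dot_tendsto u tendsto_leaf_transfer w)
    have frac: "(\<lambda>m. real (Suc m) / real (m + 7)) \<longlonglongrightarrow> 1"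
    proof -
      have "(\<lambda>m. 1 - 6 / real (m + 7)) \<longlonglongrightarrow> 1 - 0"
        using LIMSEQ_ignore_initial_segment[OF lim_const_over_n[of "6::real"], of 7]
        by (intro tendsto_intros) simp
      moreover have "1 - 6 / real (m + 7) = real (Suc m) / real (m + 7)" for m
        by (simp add: field_simps)
      ultimately show ?thesis by simp
    qed
    have w4: "(\<lambda>m. w (m + 4) ABC) \<longlonglongrightarrow> c * ?x ABC"
      using w by (rule LIMSEQ_ignore_initial_segment)
    have "(\<lambda>m. 6 * (S m / real (Suc m)) * (real (Suc m) / real (m + 7)) / (?l ^ 4 * w (m + 4) ABC))
        \<longlonglongrightarrow> 6 * dot (\<lambda>\<sigma>. d * ?y \<sigma>) (leaf_transfer (\<lambda>\<sigma>. c * ?x \<sigma>)) * 1 / (?l ^ 4 * (c * ?x ABC))"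
      using l c right_eigenvector_pos[of ABC]
      by (intro tendsto_intros S frac w4) auto
    moreover have "6 * (S m / real (Suc m)) * (real (Suc m) / real (m + 7)) / (?l ^ 4 * w (m + 4) ABC)
        = 6 * ?l ^ m * S m / (real (m + 7) * t m)" for m
      unfolding t using l by (simp del: of_nat_Suc of_nat_add add: field_simps)
    moreover have "6 * dot (\<lambda>\<sigma>. d * ?y \<sigma>) (leaf_transfer (\<lambda>\<sigma>. c * ?x \<sigma>)) * 1 / (?l ^ 4 * (c * ?x ABC)) = bz"
    proof -
      have "dot (\<lambda>\<sigma>. d * ?y \<sigma>) (leaf_transfer (\<lambda>\<sigma>. c * ?x \<sigma>)) = d * (c * dot ?y (leaf_transfer ?x))"
        by (simp only: leaf_transfer_scale dot_scale dot_commute[of "\<lambda>\<sigma>. d * ?y \<sigma>"])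
           (simp only: dot_commute[of ?y] mult.left_commute)
      then have "6 * dot (\<lambda>\<sigma>. d * ?y \<sigma>) (leaf_transfer (\<lambda>\<sigma>. c * ?x \<sigma>)) * 1 / (?l ^ 4 * (c * ?x ABC))
          = d * c * (6 * dot ?y (leaf_transfer ?x)) / (?l ^ 4 * (c * ?x ABC))"
        by simp
      also have "\<dots> = bz"
        unfolding eigenvector_ratio d_def using l c yx right_eigenvector_pos[of ABC]
        by (simp add: field_simps)
      finally show ?thesis .
    qed
    ultimately show ?thesis by simp
  qed
  ultimately have "(\<lambda>m. BZ_ratio (\<lambda>n. graph_power (path_graph n) 3) (m + 7)) \<longlonglongrightarrow> 0 + bz"
    unfolding ratio by (rule tendsto_add)
  then show ?thesis by (simp add: LIMSEQ_offset)
qed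

theorem theorem6p3p2:
  shows "convergent (BZ_ratio (\<lambda>n. graph_power (path_graph n) 3)) \<and>
    BZ (\<lambda>n. graph_power (path_graph n) 3) =
      3 / 7 * (45 / 2 + 9 * sqrt 7 - 1 / 2 * sqrt (3857 + 1684 * sqrt 7))"
  unfolding BZ_def bz_def[symmetric]
  using convergentI[OF BZ_ratio_tendsto] limI[OF BZ_ratio_tendsto] by blast

end
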